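(* Let $n\in\mathbb N$, $n\geq 1$, and let $i\in\{1,\dots,n\}$. The pair $(\mathcal K^n_{i^{+}},\mathbb R^n)$ has the $S(n)$-finite extension property.
   Context: $\mathcal K^n$ denotes the family of all (nonempty) compact convex subsets of $\mathbb R^n$, equipped with the Hausdorff metric $d_H(A,B)=\max\{\sup_{b\in B}d(b,A),\sup_{a\in A}d(a,B)\}$, where $d$ is the Euclidean metric. For $j\in\{0,\dots,n\}$, $\mathcal K^n_{j^+}=\{K\in\mathcal K^n\mid \dim(K)\geq j\}$ (with the subspace topology), where $\dim(K)$ is the dimension of the smallest affine subspace of $\mathbb R^n$ containing $K$. $S(n)$ denotes the group of all similarities of $\mathbb R^n$, i.e. all maps $g(x)=u+\lambda\sigma(x)$ with $u\in\mathbb R^n$, $\lambda>0$ and $\sigma\in O(n)$ (the orthogonal group), topologized as $\mathbb R^n\times(0,\infty)\times O(n)$. It acts naturally on $\mathbb R^n$, and on $\mathcal K^n_{j^+}$ by $gK=\{g(x)\mid x\in K\}$. For a topological group $G$, a $G$-space is a topological space with a continuous action of $G$; $G_x=\{g\in G\mid gx=x\}$ is the stabilizer of $x$ and $G(x)=\{gx\mid g\in G\}$ its orbit. A $G$-map is a continuous function $f$ between $G$-spaces with $f(gx)=gf(x)$ for all $g\in G$ and all $x$. A pair $(X,Y)$ of $G$-spaces has the $G$-finite extension property if for all finite sets $\{x_1,\dots,x_k\}\subset X$ and $\{y_1,\dots,y_k\}\subset Y$ satisfying (1) $G_{x_l}\leq G_{y_l}$ for every $l\in\{1,\dots,k\}$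 and (2) $G(x_l)\cap G(x_j)=\emptyset$ if $l\neq j$, there exists a $G$-map $\psi:X\to Y$ such that $\psi(x_l)=y_l$ for every $l\in\{1,\dots,k\}$. *)

theory Defs
  imports "HOL-Analysis.Analysis" "HOL-Algebra.Group_Action"
begin

locale topological_group = group G for G (structure) +
  fixes T :: "'a topology"
  assumes topspace_group: "topspace T = carrier G"
    and continuous_mult: "continuous_map (prod_topology T T) T (\<lambda>(g, h). g \<otimes> h)"
    and continuous_inv: "continuous_map T T (\<lambda>g. inv g)"

text \<open>As in \<^theory>\<open>HOL-Algebra.Group_Action\<close>, an action is a homomorphism into
  \<^const>\<open>BijGroup\<close>, so each \<open>\<phi> g\<close> is undefined outside the underlying set.\<close>

locale G_space =
  topological_group G T + group_action G "topspace X" \<phi>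
  for G (structure) and T and X :: "'b topology" and \<phi> +
  assumes continuous_action: "continuous_map (prod_topology T X) X (\<lambda>(g, x). \<phi> g x)"

definition G_map ::
  "('g, 'm) monoid_scheme \<Rightarrow> 'b topology \<Rightarrow> ('g \<Rightarrow> 'b \<Rightarrow> 'b) \<Rightarrow>
   'c topology \<Rightarrow> ('g \<Rightarrow> 'c \<Rightarrow> 'c) \<Rightarrow> ('b \<Rightarrow> 'c) \<Rightarrow> bool"
  where "G_map G X \<phi> Y \<theta> f \<longleftrightarrow>
    continuous_map X Y f \<and>
    (\<forall>g \<in> carrier G. \<forall>x \<in> topspace X. f (\<phi> g x) = \<theta> g (f x))"

definition G_finite_extension_property ::
  "('g, 'm) monoid_scheme \<Rightarrow> 'g topology \<Rightarrow> 'b topology \<Rightarrow> ('g \<Rightarrow> 'b \<Rightarrow> 'b) \<Rightarrow>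
   'c topology \<Rightarrow> ('g \<Rightarrow> 'c \<Rightarrow> 'c) \<Rightarrow> bool"
  where "G_finite_extension_property G T X \<phi> Y \<theta> \<longleftrightarrow>
    G_space G T X \<phi> \<and> G_space G T Y \<theta> \<and>
    (\<forall>(k::nat) x y.
       (\<forall>l \<in> {1..k}. x l \<in> topspace X \<and> y l \<in> topspace Y) \<longrightarrow>
       (\<forall>l \<in> {1..k}. stabilizer G \<phi> (x l) \<subseteq> stabilizer G \<theta> (y l)) \<longrightarrow>
       (\<forall>l \<in> {1..k}. \<forall>j \<in> {1..k}. l \<noteq> j \<longrightarrow> orbit G \<phi> (x l) \<inter> orbit G \<phi> (x j) = {}) \<longrightarrow>
       (\<exists>f. G_map G X \<phi> Y \<theta> f \<and> (\<forall>l \<in> {1..k}. f (x l) = y l)))"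

definition convex_bodies :: "'a::euclidean_space set set"
  where "convex_bodies = {K. K \<noteq> {} \<and> compact K \<and> convex K}"

text \<open>The value \<open>0\<close> outside \<^const>\<open>convex_bodies\<close> is a convention: \<^locale>\<open>Metric_space\<close>
  demands nonnegativity everywhere, and suprema of empty or unbounded sets of reals are
  unspecified.\<close>

definition hausdorff_dist :: "'a::euclidean_space set \<Rightarrow> 'a set \<Rightarrow> real"
  where "hausdorff_dist A B =
    (if A \<in> convex_bodies \<and> B \<in> convex_bodies
     then max (SUP b\<in>B. infdist b A) (SUP a\<in>A. infdist a B) else 0)"

definition convex_bodies_dim_ge :: "nat \<Rightarrow> 'a::euclidean_space set topology"
  where "convex_bodies_dim_ge j =
    subtopology (Metric_space.mtopology convex_bodies hausdorff_dist) {K. aff_dim K \<ge> int j}"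

lemma hausdorff_dist_le_iff:
  assumes A: "A \<in> convex_bodies" and B: "B \<in> convex_bodies"
  shows "hausdorff_dist A B \<le> r \<longleftrightarrow> (\<forall>b\<in>B. infdist b A \<le> r) \<and> (\<forall>a\<in>A. infdist a B \<le> r)"
proof -
  have "bdd_above ((\<lambda>b. infdist b A) ` B)" "bdd_above ((\<lambda>a. infdist a B) ` A)"
    using A B unfolding convex_bodies_def
    by (auto intro!: bounded_imp_bdd_above compact_imp_bounded compact_continuous_image
        continuous_on_infdist continuous_on_id)
  then show ?thesis
    using A B by (auto simp: hausdorff_dist_def convex_bodies_def cSUP_le_iff)
qed

lemma Metric_space_hausdorff: "Metric_space convex_bodies hausdorff_dist"
proof
  fix A B :: "'a set"
  show "0 \<le> hausdorff_dist A B"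
  proof (cases "A \<in> convex_bodies \<and> B \<in> convex_bodies")
    case True
    then obtain a where "a \<in> A" by (auto simp: convex_bodies_def)
    then have "infdist a B \<le> hausdorff_dist A B"
      using True hausdorff_dist_le_iff[of A B "hausdorff_dist A B"] by auto
    then show ?thesis using infdist_nonneg[of a B] by linarith
  qed (auto simp: hausdorff_dist_def)
  show "hausdorff_dist A B = hausdorff_dist B A"
    by (auto simp: hausdorff_dist_def max.commute)
next
  fix A B :: "'a set"
  assume A: "A \<in> convex_bodies" and B: "B \<in> convex_bodies"
  have cl: "closed A" "closed B" "A \<noteq> {}" "B \<noteq> {}"
    using A B by (auto simp: convex_bodies_def compact_imp_closed)
  obtain a where "a \<in> A" using cl by auto
  then have "infdist a B \<le> hausdorff_dist A B"
    using hausdorff_dist_le_iff[OF A B, of "hausdorff_dist A B"] by auto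
  then have "0 \<le> hausdorff_dist A B"
    using infdist_nonneg[of a B] by linarith
  then have "hausdorff_dist A B = 0 \<longleftrightarrow> hausdorff_dist A B \<le> 0"
    by linarith
  also have "\<dots> \<longleftrightarrow> (\<forall>b\<in>B. infdist b A = 0) \<and> (\<forall>a\<in>A. infdist a B = 0)"
    unfolding hausdorff_dist_le_iff[OF A B] by (metis infdist_nonneg order_antisym order_refl)
  also have "\<dots> \<longleftrightarrow> A = B"
    using cl in_closed_iff_infdist_zero[of A] in_closed_iff_infdist_zero[of B] by auto
  finally show "hausdorff_dist A B = 0 \<longleftrightarrow> A = B" .
next
  fix A B C :: "'a set"
  assume A: "A \<in> convex_bodies" and B: "B \<in> convex_bodies" and C: "C \<in> convex_bodies"
  have half: "infdist p R \<le> hausdorff_dist P Q + hausdorff_dist Q R"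
    if P: "P \<in> convex_bodies" and Q: "Q \<in> convex_bodies" and R: "R \<in> convex_bodies"
      and p: "p \<in> P" for P Q R :: "'a set" and p
  proof -
    have "closed Q" "Q \<noteq> {}"
      using Q by (auto simp: convex_bodies_def compact_imp_closed)
    then obtain q where q: "q \<in> Q" "infdist p Q = dist p q"
      using infdist_attains_inf by blast
    have "infdist p R \<le> infdist q R + dist p q" by (rule infdist_triangle)
    moreover have "infdist p Q \<le> hausdorff_dist P Q"
      using hausdorff_dist_le_iff[OF P Q, of "hausdorff_dist P Q"] p by auto
    moreover have "infdist q R \<le> hausdorff_dist Q R"
      using hausdorff_dist_le_iff[OF Q R, of "hausdorff_dist Q R"] q by auto
    ultimately show ?thesis using q by linarith
  qed
  have comm: "hausdorff_dist P Q = hausdorff_dist Q P" for P Q :: "'a set"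
    by (auto simp: hausdorff_dist_def max.commute)
  show "hausdorff_dist A C \<le> hausdorff_dist A B + hausdorff_dist B C"
    unfolding hausdorff_dist_le_iff[OF A C]
    using half[OF A B C] half[OF C B A] comm[of A B] comm[of B C] by force
qed

lemma topspace_convex_bodies_dim_ge:
  "topspace (convex_bodies_dim_ge j) = {K \<in> convex_bodies. aff_dim K \<ge> int j}"
  by (auto simp: convex_bodies_dim_ge_def
      Metric_space.topspace_mtopology[OF Metric_space_hausdorff])

definition similarity_params :: "((real^'n) \<times> real \<times> (real^'n^'n)) topology"
  where "similarity_params =
    prod_topology euclidean
      (prod_topology (top_of_set {0<..}) (top_of_set {A. orthogonal_matrix A}))"

definition similarity_map :: "(real^'n) \<times> real \<times> (real^'n^'n) \<Rightarrow> real^'n \<Rightarrow> real^'n"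
  where "similarity_map = (\<lambda>(u, c, A) x. u + c *\<^sub>R (A *v x))"

definition similarities :: "(real^'n \<Rightarrow> real^'n) set"
  where "similarities = similarity_map ` topspace similarity_params"

definition similarity_group :: "(real^'n \<Rightarrow> real^'n) monoid"
  where "similarity_group = \<lparr>carrier = similarities, mult = (\<circ>), one = id\<rparr>"

text \<open>The topology transported along the bijection from \<open>\<real>\<^sup>n \<times> (0,\<infinity>) \<times> O(n)\<close>
  (see \<open>inj_on_similarity_map\<close> below).\<close>

definition similarity_topology :: "(real^'n \<Rightarrow> real^'n) topology"
  where "similarity_topology =
    pullback_topology similarities
      (inv_into (topspace similarity_params) similarity_map) similarity_params"

lemma inj_on_similarity_map:
  "inj_on similarity_map (topspace (similarity_params :: ((real^'n) \<times> real \<times> (real^'n^'n)) topology))"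
proof (rule inj_onI)
  fix p q :: "(real^'n) \<times> real \<times> (real^'n^'n)"
  assume p: "p \<in> topspace similarity_params" and q: "q \<in> topspace similarity_params"
    and eq: "similarity_map p = similarity_map q"
  obtain u c A where p': "p = (u, c, A)" by (cases p)
  obtain v d B where q': "q = (v, d, B)" by (cases q)
  have c: "c > 0" "orthogonal_matrix A" and d: "d > 0" "orthogonal_matrix B"
    using p q by (auto simp: p' q' similarity_params_def)
  have e: "u + c *\<^sub>R (A *v x) = v + d *\<^sub>R (B *v x)" for x
    using fun_cong[OF eq, of x] by (simp add: p' q' similarity_map_def)
  have "u = v" using e[of 0] by simp
  with e have e': "c *\<^sub>R (A *v x) = d *\<^sub>R (B *v x)" for x by simp
  have nrm: "norm (M *v x) = norm x" if "orthogonal_matrix M" for M :: "real^'n^'n" and x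
    using that orthogonal_transformation_matrix[of "(*v) M"]
    by (auto simp: orthogonal_transformation)
  have "c = d"
    using arg_cong[OF e'[of "axis undefined 1"], of norm] c d by (simp add: nrm)
  with e' c have "A *v x = B *v x" for x by simp
  then have "A = B" by (simp add: matrix_eq)
  with \<open>u = v\<close> \<open>c = d\<close> show "p = q" by (simp add: p' q')
qed

definition similarity_action_point :: "(real^'n \<Rightarrow> real^'n) \<Rightarrow> real^'n \<Rightarrow> real^'n"
  where "similarity_action_point g x = g x"

definition similarity_action_body ::
  "nat \<Rightarrow> (real^'n \<Rightarrow> real^'n) \<Rightarrow> (real^'n) set \<Rightarrow> (real^'n) set"
  where "similarity_action_body j g =
    (\<lambda>K \<in> topspace (convex_bodies_dim_ge j). g ` K)"

end

theory Submission
  imports Defs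
begin

text \<open>
  The ball of least radius containing a body \<open>K\<close> is unique. Its centre \<open>p\<close> and radius \<open>r\<close> depend
  continuously on \<open>K\<close>, and a similarity \<open>g(x) = u + cAx\<close> turns them into \<open>g(p)\<close> and \<open>cr\<close>. A body of
  dimension at least one has \<open>r > 0\<close>, hence a normal form \<open>(K - p) / r\<close>, which depends continuously on
  \<open>K\<close> and on which \<open>g\<close> acts through \<open>A\<close> alone. Therefore
  \<open>f(K) = p + r F(K)\<close> is a similarity-equivariant map as soon as \<open>F\<close> is continuous and satisfies
  \<open>F(gK) = A F(K)\<close> (\<open>linear_part_equivariant\<close>), and the noncompact part of the group has disappeared
  from the problem. The required values of \<open>F\<close> are \<open>w\<^sub>l = (y\<^sub>l - p\<^sub>l) / r\<^sub>l\<close> at \<open>x\<^sub>l\<close>, and the condition on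
  the stabilizers says that every orthogonal matrix preserving the normal form \<open>N\<^sub>l\<close> of \<open>x\<^sub>l\<close> fixes \<open>w\<^sub>l\<close>.

  The classical way to extend an equivariant map from an orbit of a compact group is to extend it
  by Tietze's theorem and then to average over Haar measure. Here a convex minimisation replaces
  both. For \<open>L \<ge> 0\<close> and a single pair \<open>(N, w)\<close>, let \<open>F(M)\<close> be the point \<open>z\<close> minimising
  \<open>sup\<^sub>A (|z - Aw|\<^sup>2 - L d\<^sub>H(M', AN))\<close>, where \<open>A\<close> runs over the orthogonal matrices and \<open>M'\<close> is the normal
  form of \<open>M\<close>. Suprema of functions of the form
  \<open>|z - q|\<^sup>2 - b\<close> are uniformly convex, so that the minimiser exists, is unique and is stable under
  changes of the weights \<open>b\<close> (\<open>weighted_centre_exists\<close>, \<open>weighted_centre_stable\<close>); uniqueness makes \<open>F\<close>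
  equivariant and stability makes it continuous. At \<open>M' = N\<close> and for large \<open>L\<close> the minimiser lies near
  \<open>w\<close>, because by compactness only matrices that hardly move \<open>w\<close> have \<open>AN\<close> close to \<open>N\<close>
  (\<open>orthogonal_displacement_le\<close>). The values at a fixed body of all admissible \<open>F\<close> form a linear subspace
  of \<open>\<real>\<^sup>n\<close>; subspaces are closed, so \<open>w\<close> itself is a value (\<open>ex_linear_part_equivariant_value\<close>).
  With all \<open>b\<close> equal to \<open>0\<close> the same minimisation yields the circumscribed ball.

  Finally, the distance from the normal form of \<open>K\<close> to the orthogonal orbit of \<open>N\<^sub>j\<close> is a continuous
  invariant of \<open>K\<close>. It vanishes at \<open>x\<^sub>j\<close> and, as the orbits are disjoint and compactness makes the distance
  attained, at no other \<open>x\<^sub>l\<close>. Products of these distances give invariant coefficients with which the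
  maps \<open>F\<^sub>l\<close> for the single orbits are combined.
\<close>

section \<open>Continuity criteria\<close>

text \<open>The maps on convex bodies below come with explicit bounds on how far their value at \<open>y\<close> is from their value at a
  fixed \<open>x\<close>. It is enough that such a bound is continuous in \<open>y\<close> and vanishes at \<open>x\<close>, whatever the topology
  of the domain.\<close>

lemma (in Metric_space) continuous_map_into_mtopology_bound:
  assumes "\<And>x. x \<in> topspace X \<Longrightarrow> f x \<in> M"
    and "\<And>x. x \<in> topspace X \<Longrightarrow> \<exists>\<beta>. continuous_map X euclideanreal \<beta> \<and> \<beta> x = 0 \<and>
           (\<forall>y\<in>topspace X. d (f x) (f y) \<le> \<beta> y)"
  shows "continuous_map X mtopology f"
  unfolding continuous_map_to_metric
proof (intro ballI allI impI)
  fix x \<epsilon> assume x: "x \<in> topspace X" and "(0::real) < \<epsilon>"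
  obtain \<beta> where \<beta>: "continuous_map X euclideanreal \<beta>" "\<beta> x = 0"
    "\<And>y. y \<in> topspace X \<Longrightarrow> d (f x) (f y) \<le> \<beta> y"
    using assms(2)[OF x] by blast
  have "openin X {y \<in> topspace X. \<beta> y \<in> {..<\<epsilon>}}"
    by (rule openin_continuous_map_preimage[OF \<beta>(1)]) auto
  then show "\<exists>U. openin X U \<and> x \<in> U \<and> (\<forall>y\<in>U. f y \<in> mball (f x) \<epsilon>)"
    using x \<open>0 < \<epsilon>\<close> \<beta>(2,3) assms(1) by (intro exI[of _ "{y \<in> topspace X. \<beta> y \<in> {..<\<epsilon>}}"]) (auto intro: le_less_trans)
qed

lemma continuous_map_into_euclidean_bound:
  fixes f :: "'a \<Rightarrow> 'b::metric_space"
  assumes "\<And>x. x \<in> topspace X \<Longrightarrow> \<exists>\<beta>. continuous_map X euclideanreal \<beta> \<and> \<beta> x = 0 \<and>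
           (\<forall>y\<in>topspace X. dist (f x) (f y) \<le> \<beta> y)"
  shows "continuous_map X euclidean f"
  using Met_TC.continuous_map_into_mtopology_bound[of X f] assms
  by simp

lemma continuous_map_euclidean_compose2:
  fixes f :: "'a \<Rightarrow> 'b::topological_space" and g :: "'a \<Rightarrow> 'c::topological_space"
  assumes "continuous_map X (top_of_set S) f" "continuous_map X (top_of_set T) g"
    and "continuous_on (S \<times> T) (\<lambda>p. h (fst p) (snd p))"
  shows "continuous_map X euclidean (\<lambda>x. h (f x) (g x))"
proof -
  have "continuous_map X (top_of_set (S \<times> T)) (\<lambda>x. (f x, g x))"
    using assms(1,2) by (simp add: continuous_map_pairedI flip: prod_topology_subtopology_eu)
  then have "continuous_map X euclidean ((\<lambda>p. h (fst p) (snd p)) \<circ> (\<lambda>x. (f x, g x)))"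
    by (rule continuous_map_compose) (use assms(3) in simp)
  then show ?thesis by (simp add: o_def)
qed

lemma continuous_map_scaleR_euclidean:
  fixes F :: "'a \<Rightarrow> 'b::real_normed_vector"
  assumes "continuous_map X euclideanreal f" "continuous_map X euclidean F"
  shows "continuous_map X euclidean (\<lambda>x. f x *\<^sub>R F x)"
  using assms by (intro continuous_map_euclidean_compose2[where h = scaleR and S = UNIV and T = UNIV])
    (auto intro!: continuous_intros)

section \<open>Matrices\<close>

lemma norm_matrix_vector_mult_le:
  fixes A :: "real^'n^'m"
  shows "norm (A *v x) \<le> norm A * norm x"
proof -
  have "norm (A *v x) = L2_set (\<lambda>i. \<bar>A $ i \<bullet> x\<bar>) UNIV"
    by (simp add: norm_vec_def matrix_vector_mul_component)
  also have "\<dots> \<le> L2_set (\<lambda>i. norm (A $ i) * norm x) UNIV"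
    by (rule L2_set_mono) (auto simp: Cauchy_Schwarz_ineq2)
  also have "\<dots> = norm A * norm x"
    by (simp add: norm_vec_def[of A] L2_set_left_distrib)
  finally show ?thesis .
qed

abbreviation orthogonal_matrices :: "(real^'n^'n) set"
  where "orthogonal_matrices \<equiv> {A. orthogonal_matrix A}"

lemma norm_orthogonal_matrix_mult:
  assumes "orthogonal_matrix (A :: real^'n^'n)"
  shows "norm (A *v x) = norm x"
  using assms orthogonal_transformation_matrix[of "(*v) A"]
  by (auto simp: orthogonal_transformation)

lemma orthogonal_matrix_transposeI: "orthogonal_matrix A \<Longrightarrow> orthogonal_matrix (transpose A)"
  by (simp add: orthogonal_matrix_transpose)

lemma orthogonal_matrix_cancel:
  assumes "orthogonal_matrix (A :: real^'n^'n)"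
  shows "transpose A *v (A *v x) = x" "A *v (transpose A *v x) = x"
  using assms by (simp_all add: orthogonal_matrix_def matrix_vector_mul_assoc
      del: transpose_matrix_vector)

lemma dist_orthogonal_matrix_mult:
  assumes "orthogonal_matrix (A :: real^'n^'n)"
  shows "dist (A *v x) (A *v y) = dist x y"
  using norm_orthogonal_matrix_mult[OF assms, of "x - y"]
  by (simp add: dist_norm matrix_vector_mult_diff_distrib)

lemma continuous_on_matrix_mult [continuous_intros]:
  fixes f :: "'a::topological_space \<Rightarrow> real^'k^'m" and g :: "'a \<Rightarrow> real^'n^'k"
  assumes "continuous_on S f" "continuous_on S g"
  shows "continuous_on S (\<lambda>x. f x ** g x)"
  unfolding matrix_matrix_mult_def
  by (intro continuous_intros assms)

lemma continuous_on_matrix_vector_mult_fun [continuous_intros]: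
  fixes f :: "'a::topological_space \<Rightarrow> real^'k^'m"
  assumes "continuous_on S f" "continuous_on S g"
  shows "continuous_on S (\<lambda>x. f x *v g x)"
  unfolding matrix_vector_mult_def
  by (intro continuous_intros assms)

lemma continuous_on_transpose [continuous_intros]:
  fixes f :: "'a::topological_space \<Rightarrow> real^'k^'m"
  assumes "continuous_on S f"
  shows "continuous_on S (\<lambda>x. transpose (f x))"
  unfolding transpose_def
  by (intro continuous_intros assms)

lemma compact_orthogonal_matrices: "compact (orthogonal_matrices :: (real^'n^'n) set)"
  unfolding compact_eq_bounded_closed
proof
  have "norm A \<le> real CARD('n)" if "orthogonal_matrix A" for A :: "real^'n^'n"
  proof -
    have "norm (A $ i) = 1" for i
      using that by (simp add: orthogonal_matrix_orthonormal_rows row_def)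
    then show ?thesis
      using L2_set_le_sum[of UNIV "\<lambda>i. norm (A $ i)"] by (simp add: norm_vec_def)
  qed
  then show "bounded {A :: real^'n^'n. orthogonal_matrix A}"
    by (auto simp: bounded_iff)
  show "closed {A :: real^'n^'n. orthogonal_matrix A}"
    unfolding orthogonal_matrix
    by (intro closed_Collect_eq continuous_intros)
qed

section \<open>The similarity group as a topological group\<close>

abbreviation sim_params :: "((real^'n) \<times> real \<times> (real^'n^'n)) set"
  where "sim_params \<equiv> UNIV \<times> {0<..} \<times> orthogonal_matrices"

lemma similarity_params_eq: "similarity_params = top_of_set sim_params"
  unfolding similarity_params_def 
  by (metis prod_topology_subtopology_eu subtopology_UNIV)

lemma topspace_sim_params: "topspace similarity_params = sim_params"
  by (simp add: similarity_params_eq)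

lemma similaritiesE:
  assumes "g \<in> similarities"
  obtains u c A where "c > 0" "orthogonal_matrix A" "g = (\<lambda>x. u + c *\<^sub>R (A *v x))"
  using assms unfolding similarities_def similarity_params_eq
  by (force simp: similarity_map_def fun_eq_iff)

lemma similaritiesI:
  assumes "c > 0" "orthogonal_matrix A"
  shows "(\<lambda>x. u + c *\<^sub>R (A *v x)) \<in> similarities"
  unfolding similarities_def similarity_params_eq
  by (rule image_eqI[of _ _ "(u, c, A)"]) (use assms in \<open>auto simp: similarity_map_def\<close>)

text \<open>By definition the topology of the group is the one that makes this map a homeomorphism onto the
  parameter space, so continuity questions about similarities become questions about explicit
  formulas in \<open>(u, c, A)\<close>.\<close>

definition sim_coords :: "(real^'n \<Rightarrow> real^'n) \<Rightarrow> (real^'n) \<times> real \<times> (real^'n^'n)"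
  where "sim_coords = inv_into (topspace similarity_params) similarity_map"

lemma sim_coords:
  assumes "g \<in> similarities"
  shows "sim_coords g \<in> sim_params" "similarity_map (sim_coords g) = g"
  using assms inv_into_into[of g similarity_map "topspace similarity_params"]
    f_inv_into_f[of g similarity_map "topspace similarity_params"]
  unfolding sim_coords_def similarities_def by (simp_all add: similarity_params_eq)

lemma topspace_similarity_topology: "topspace similarity_topology = similarities"
  using sim_coords(1)[folded topspace_sim_params]
  by (auto simp: similarity_topology_def topspace_pullback_topology sim_coords_def[symmetric]
     similarity_params_eq[symmetric])

lemma continuous_map_sim_coords:
  "continuous_map similarity_topology (top_of_set sim_params) sim_coords"
  using continuous_map_pullback[OF continuous_map_id, of similarities sim_coords similarity_params]
  by (simp add: similarity_topology_def sim_coords_def similarity_params_eq)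

lemma continuous_map_similarity_map:
  "continuous_map (top_of_set sim_params) similarity_topology similarity_map"
  unfolding similarity_topology_def similarity_params_eq[symmetric]
proof (rule continuous_map_pullback')
  show "continuous_map similarity_params similarity_params
     (inv_into (topspace similarity_params) similarity_map \<circ> similarity_map)"
    by (rule continuous_map_eq[OF continuous_map_id]) (simp add: inj_on_similarity_map)
qed (auto simp: similarities_def)

lemma similarity_map_comp:
  "similarity_map (u, c, A) \<circ> similarity_map (v, d, B) = similarity_map (u + c *\<^sub>R (A *v v), c * d, A ** B)"
  by (auto simp: similarity_map_def fun_eq_iff matrix_vector_right_distrib
      matrix_vector_mult_scaleR matrix_vector_mul_assoc scaleR_right_distrib)

lemma similarity_map_inverse:
  assumes "c > 0" "orthogonal_matrix A"
  shows "similarity_map (- ((1/c) *\<^sub>R (transpose A *v u)), 1/c, transpose A) \<circ> similarity_map (u, c, A) = id"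
  using assms
  by (auto simp: similarity_map_def fun_eq_iff matrix_vector_right_distrib
      matrix_vector_mult_scaleR orthogonal_matrix_cancel scaleR_right_distrib
      simp del: transpose_matrix_vector)

lemma group_similarity_group: "group (similarity_group :: (real^'n \<Rightarrow> real^'n) monoid)"
proof (rule groupI)
  fix g h :: "real^'n \<Rightarrow> real^'n"
  assume "g \<in> carrier similarity_group" "h \<in> carrier similarity_group"
  then obtain u c A v d B where "c > 0" "orthogonal_matrix A" "d > 0" "orthogonal_matrix B"
    and "g = similarity_map (u, c, A)" "h = similarity_map (v, d, B)"
    by (auto simp: similarity_group_def similarities_def similarity_params_eq)
  then show "g \<otimes>\<^bsub>similarity_group\<^esub> h \<in> carrier similarity_group"
    by (simp add: similarity_group_def similarities_def similarity_params_eq similarity_map_comp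
        orthogonal_matrix_mul)
next
  show "\<one>\<^bsub>similarity_group\<^esub> \<in> carrier (similarity_group :: (real^'n \<Rightarrow> real^'n) monoid)"
    using similaritiesI[of 1 "mat 1" "0::real^'n"]
    by (simp add: similarity_group_def orthogonal_matrix_id id_def)
next
  fix g :: "real^'n \<Rightarrow> real^'n"
  assume "g \<in> carrier similarity_group"
  then obtain u c A where g: "c > 0" "orthogonal_matrix A" "g = similarity_map (u, c, A)"
    by (auto simp: similarity_group_def similarities_def similarity_params_eq)
  let ?p = "(- ((1/c) *\<^sub>R (transpose A *v u)), 1/c, transpose A)"
  have "similarity_map ?p \<in> similarities"
    unfolding similarities_def similarity_params_eq
    by (rule imageI) (use g in \<open>simp add: orthogonal_matrix_transposeI\<close>)
  then show "\<exists>h \<in> carrier similarity_group. h \<otimes>\<^bsub>similarity_group\<^esub> g = \<one>\<^bsub>similarity_group\<^esub>"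
    using similarity_map_inverse[OF g(1,2)] g(3) by (auto simp: similarity_group_def)
qed (auto simp: similarity_group_def comp_assoc)

lemma topological_group_similarity_group:
  "topological_group (similarity_group :: (real^'n \<Rightarrow> real^'n) monoid) similarity_topology"
proof -
  interpret S: group "similarity_group :: (real^'n \<Rightarrow> real^'n) monoid"
    by (rule group_similarity_group)
  let ?P = "sim_params :: ((real^'n) \<times> real \<times> (real^'n^'n)) set"
  let ?mul = "\<lambda>((u, c, A), (v, d, B)). (u + c *\<^sub>R (A *v v), c * d, A ** B)
    :: (real^'n) \<times> real \<times> (real^'n^'n)"
  let ?inv = "\<lambda>(u, c, A). (- ((1/c) *\<^sub>R (transpose A *v u)), 1/c, transpose A)
    :: (real^'n) \<times> real \<times> (real^'n^'n)"
  show ?thesis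
  proof
    show "topspace similarity_topology = carrier (similarity_group :: (real^'n \<Rightarrow> real^'n) monoid)"
      by (simp add: topspace_similarity_topology similarity_group_def)
    have "continuous_map (top_of_set (?P \<times> ?P)) (top_of_set ?P) ?mul"
      by (auto simp: case_prod_unfold orthogonal_matrix_mul intro!: continuous_intros)
    \<comment> \<open>Composition is the polynomial map on parameters, conjugated by the coordinates.\<close>
    then have "continuous_map (prod_topology similarity_topology similarity_topology) similarity_topology
        (similarity_map \<circ> (?mul \<circ> (\<lambda>(g, h). (sim_coords g, sim_coords h))))"
      using continuous_map_sim_coords
      by (intro continuous_map_compose[OF _ continuous_map_similarity_map]
          continuous_map_compose[of _ "top_of_set (?P \<times> ?P)"])
        (auto simp flip: prod_topology_subtopology_eu simp: continuous_map_prod_top)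
    then show "continuous_map (prod_topology similarity_topology similarity_topology)
        similarity_topology (\<lambda>(g, h :: real^'n \<Rightarrow> real^'n). g \<otimes>\<^bsub>similarity_group\<^esub> h)"
    proof (rule continuous_map_eq)
      fix p :: "(real^'n \<Rightarrow> real^'n) \<times> (real^'n \<Rightarrow> real^'n)"
      assume "p \<in> topspace (prod_topology similarity_topology similarity_topology)"
      then have "fst p \<in> similarities" "snd p \<in> similarities"
        by (auto simp: topspace_similarity_topology)
      from sim_coords(2)[OF this(1)] sim_coords(2)[OF this(2)]
      show "(similarity_map \<circ> (?mul \<circ> (\<lambda>(g, h). (sim_coords g, sim_coords h)))) p =
        (case p of (g, h) \<Rightarrow> g \<otimes>\<^bsub>similarity_group\<^esub> h)"
        by (cases p; cases "sim_coords (fst p)"; cases "sim_coords (snd p)")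
          (auto simp: similarity_group_def similarity_map_comp[symmetric])
    qed
    have "continuous_map (top_of_set ?P) (top_of_set ?P) ?inv"
      by (auto simp: case_prod_unfold orthogonal_matrix_transposeI simp del: transpose_matrix_vector intro!: continuous_intros)
    then have "continuous_map similarity_topology similarity_topology
        (similarity_map \<circ> (?inv \<circ> sim_coords))"
      using continuous_map_sim_coords
      by (intro continuous_map_compose[OF _ continuous_map_similarity_map] continuous_map_compose)
    then show "continuous_map similarity_topology similarity_topology
       (\<lambda>g :: real^'n \<Rightarrow> real^'n. inv\<^bsub>similarity_group\<^esub> g)"
    proof (rule continuous_map_eq)
      fix g :: "real^'n \<Rightarrow> real^'n"
      assume "g \<in> topspace similarity_topology"
      then have g: "g \<in> similarities"
        by (simp add: topspace_similarity_topology)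
      obtain u c A where p: "sim_coords g = (u, c, A)" by (cases "sim_coords g")
      have *: "c > 0" "orthogonal_matrix A" "g = similarity_map (u, c, A)"
        using sim_coords[OF g] p by auto
      have "similarity_map (?inv (u, c, A)) \<in> similarities"
        unfolding similarities_def similarity_params_eq
        by (rule imageI) (use * in \<open>simp add: orthogonal_matrix_transposeI\<close>)
      then show "(similarity_map \<circ> (?inv \<circ> sim_coords)) g = inv\<^bsub>similarity_group\<^esub> g"
        using similarity_map_inverse[OF *(1,2), of u, folded *(3)] g
        by (intro S.inv_equality[symmetric]) (auto simp: p similarity_group_def)
    qed
  qed
qed

section \<open>Similarities and convex bodies\<close>

lemma similarity_group_simps [simp]:
  "carrier similarity_group = similarities"
  "g \<otimes>\<^bsub>similarity_group\<^esub> h = g \<circ> h"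
  "\<one>\<^bsub>similarity_group\<^esub> = id"
  by (simp_all add: similarity_group_def)

lemma dist_similarity:
  fixes A :: "real^'n^'n"
  assumes "c > 0" "orthogonal_matrix A"
  shows "dist (u + c *\<^sub>R (A *v x)) (u + c *\<^sub>R (A *v y)) = c * dist x y"
  using dist_orthogonal_matrix_mult[OF assms(2), of x y] assms(1)
  by (simp add: dist_norm flip: scaleR_right_diff_distrib)

lemma similarity_inverse:
  assumes "g \<in> similarities"
  obtains h where "h \<in> similarities" "h \<circ> g = id" "g \<circ> h = id"
proof -
  interpret S: group "similarity_group :: (real^'a \<Rightarrow> real^'a) monoid"
    by (rule group_similarity_group)
  show thesis
    using that[of "inv\<^bsub>similarity_group\<^esub> g"] assms S.inv_closed[of g] S.l_inv[of g] S.r_inv[of g]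
    by simp
qed

text \<open>Linear maps cannot raise the dimension; applying this also to the inverse gives equality.\<close>

lemma aff_dim_similarity_image:
  assumes g: "g \<in> similarities"
  shows "aff_dim (g ` K) = aff_dim K"
proof -
  have le: "aff_dim (h ` L) \<le> aff_dim L" if hs: "h \<in> similarities" for h :: "real^'a \<Rightarrow> real^'a" and L
  proof -
    obtain u c A where h: "c > 0" "orthogonal_matrix A" "h = (\<lambda>x. u + c *\<^sub>R (A *v x))"
      by (rule similaritiesE[OF hs])
    have "linear (\<lambda>x. c *\<^sub>R (A *v x))"
      by (intro linear_compose_scale_right matrix_vector_mul_linear)
    then have "aff_dim ((\<lambda>x. c *\<^sub>R (A *v x)) ` L) \<le> aff_dim L"
      by (rule aff_dim_linear_image_le)
    then show ?thesis
      using aff_dim_translation_eq[of u "(\<lambda>x. c *\<^sub>R (A *v x)) ` L"] by (simp add: h(3) image_image)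
  qed
  obtain h where "h \<in> similarities" "h \<circ> g = id"
    using similarity_inverse[OF g] by metis
  then have "aff_dim K \<le> aff_dim (g ` K)"
    using le[of h "g ` K"] by (simp add: image_comp)
  with le[OF g, of K] show ?thesis by simp
qed

lemma convex_bodies_similarity_image:
  assumes "g \<in> similarities" "K \<in> convex_bodies"
  shows "g ` K \<in> convex_bodies"
proof -
  obtain u c A where g: "c > 0" "orthogonal_matrix A" "g = (\<lambda>x. u + c *\<^sub>R (A *v x))"
    by (rule similaritiesE[OF assms(1)])
  have lin: "linear (\<lambda>x. c *\<^sub>R (A *v x))"
    by (intro linear_compose_scale_right matrix_vector_mul_linear)
  have "g ` K = (+) u ` ((\<lambda>x. c *\<^sub>R (A *v x)) ` K)"
    by (simp add: g(3) image_image)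
  then show ?thesis
    using assms(2) compact_continuous_image[OF linear_continuous_on[OF linear_conv_bounded_linear[THEN iffD1, OF lin]], of K]
      convex_linear_image[OF lin, of K]
    by (auto simp: convex_bodies_def compact_translation convex_translation)
qed

lemma convex_bodies_dim_ge_similarity_image:
  assumes "g \<in> similarities" "K \<in> topspace (convex_bodies_dim_ge j)"
  shows "g ` K \<in> topspace (convex_bodies_dim_ge j)"
  using assms
  by (simp add: topspace_convex_bodies_dim_ge convex_bodies_similarity_image aff_dim_similarity_image)

text \<open>Distances to a compact set are attained, so the infima in the Hausdorff distance can be replaced by
  witnesses.\<close>

lemma hausdorff_dist_le_iff_near:
  assumes A: "A \<in> convex_bodies" and B: "B \<in> convex_bodies"
  shows "hausdorff_dist A B \<le> r \<longleftrightarrow>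
    (\<forall>a\<in>A. \<exists>b\<in>B. dist a b \<le> r) \<and> (\<forall>b\<in>B. \<exists>a\<in>A. dist a b \<le> r)"
proof -
  have near: "infdist p Q \<le> r \<longleftrightarrow> (\<exists>q\<in>Q. dist p q \<le> r)" if "Q \<in> convex_bodies" for p :: 'a and Q
  proof -
    have "closed Q" "Q \<noteq> {}"
      using that by (auto simp: convex_bodies_def compact_imp_closed)
    then obtain q where "q \<in> Q" "infdist p Q = dist p q"
      using infdist_attains_inf by blast
    then show ?thesis
      by (metis infdist_le order_trans)
  qed
  show ?thesis
    unfolding hausdorff_dist_le_iff[OF A B] using near[OF A] near[OF B]
    by (simp add: dist_commute conj_commute)
qed

lemmas hausdorff_dist_leI = hausdorff_dist_le_iff_near[THEN iffD2, OF _ _ conjI]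

lemma hausdorff_dist_near:
  assumes "A \<in> convex_bodies" "B \<in> convex_bodies"
  shows "\<And>a. a \<in> A \<Longrightarrow> \<exists>b\<in>B. dist a b \<le> hausdorff_dist A B"
    and "\<And>b. b \<in> B \<Longrightarrow> \<exists>a\<in>A. dist a b \<le> hausdorff_dist A B"
  using hausdorff_dist_le_iff_near[OF assms, of "hausdorff_dist A B"] by auto

lemma hausdorff_dist_commute: "hausdorff_dist A B = hausdorff_dist B A"
  by (rule Metric_space.commute[OF Metric_space_hausdorff])

lemma hausdorff_dist_nonneg: "0 \<le> hausdorff_dist A B"
  by (rule Metric_space.nonneg[OF Metric_space_hausdorff])

lemma hausdorff_dist_reverse_triangle:
  assumes "K \<in> convex_bodies" "L \<in> convex_bodies" "M \<in> convex_bodies"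
  shows "\<bar>hausdorff_dist K M - hausdorff_dist L M\<bar> \<le> hausdorff_dist K L"
  using Metric_space.mdist_reverse_triangle[OF Metric_space_hausdorff assms(1,3,2)]
  by (simp add: hausdorff_dist_commute)

text \<open>The estimate behind every continuity statement about moving bodies: it separates the error from
  changing the map, measured on \<open>K\<close> only, from the error due to changing the body.\<close>

lemma hausdorff_dist_similarity_images_le:
  fixes g h :: "real^'n \<Rightarrow> real^'n"
  assumes g: "g \<in> similarities" and h: "h \<in> similarities"
    and K: "K \<in> convex_bodies" and L: "L \<in> convex_bodies"
    and close: "\<And>x. x \<in> K \<Longrightarrow> dist (g x) (h x) \<le> e"
    and lip: "\<And>x y. dist (h x) (h y) \<le> c * dist x y" and "0 \<le> c"
  shows "hausdorff_dist (g ` K) (h ` L) \<le> e + c * hausdorff_dist K L"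
proof (rule hausdorff_dist_leI)
  have *: "dist (g a) (h b) \<le> e + c * hausdorff_dist K L"
    if "a \<in> K" "dist a b \<le> hausdorff_dist K L" for a b
    using close[OF that(1)] lip[of a b] mult_left_mono[OF that(2) \<open>0 \<le> c\<close>]
      dist_triangle[of "g a" "h b" "h a"] by linarith
  show "\<forall>a\<in>g ` K. \<exists>b\<in>h ` L. dist a b \<le> e + c * hausdorff_dist K L"
    using hausdorff_dist_near(1)[OF K L] * by blast
  show "\<forall>b\<in>h ` L. \<exists>a\<in>g ` K. dist a b \<le> e + c * hausdorff_dist K L"
    using hausdorff_dist_near(2)[OF K L] * by blast
qed (use assms convex_bodies_similarity_image in auto)

lemma hausdorff_dist_similarity_image:
  fixes A :: "real^'n^'n"
  assumes c: "c > 0" "orthogonal_matrix A" and K: "K \<in> convex_bodies" and L: "L \<in> convex_bodies"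
  shows "hausdorff_dist ((\<lambda>x. u + c *\<^sub>R (A *v x)) ` K) ((\<lambda>x. u + c *\<^sub>R (A *v x)) ` L)
    = c * hausdorff_dist K L" (is "?l = ?r")
proof (rule order_antisym)
  let ?g = "\<lambda>x. u + c *\<^sub>R (A *v x)"
  have g: "?g \<in> similarities" by (rule similaritiesI[OF c])
  show "?l \<le> ?r"
    using hausdorff_dist_similarity_images_le[OF g g K L, of 0 c] dist_similarity[OF c, of u] c by simp
  have gb: "?g ` K \<in> convex_bodies" "?g ` L \<in> convex_bodies"
    using g K L convex_bodies_similarity_image by blast+
  obtain h where h: "h \<in> similarities" "h \<circ> ?g = id" "?g \<circ> h = id"
    using similarity_inverse[OF g] .
  have "dist (h x) (h y) \<le> (1 / c) * dist x y" for x y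
  proof -
    have "?g (h z) = z" for z
      using fun_cong[OF h(3), of z] by simp
    then have "dist x y = c * dist (h x) (h y)"
      using dist_similarity[OF c, of u "h x" "h y"] by simp
    then show ?thesis using c by simp
  qed
  \<comment> \<open>The reverse inequality is the first one for the inverse, which scales distances by \<open>1 / c\<close>.\<close>
  then have "hausdorff_dist (h ` ?g ` K) (h ` ?g ` L) \<le> 0 + (1 / c) * ?l"
    using c by (intro hausdorff_dist_similarity_images_le h gb) auto
  then have "hausdorff_dist K L \<le> (1 / c) * ?l"
    using h(2) by (simp add: image_comp)
  then show "?r \<le> ?l" using c by (simp add: field_simps)
qed

lemma topspace_bodies_subset: "K \<in> topspace (convex_bodies_dim_ge j) \<Longrightarrow> K \<in> convex_bodies"
  by (simp add: topspace_convex_bodies_dim_ge)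

lemma continuous_map_hausdorff_dist_from:
  assumes "K \<in> convex_bodies"
  shows "continuous_map (convex_bodies_dim_ge j) euclideanreal (hausdorff_dist K)"
proof -
  interpret H: Metric_space convex_bodies hausdorff_dist
    by (rule Metric_space_hausdorff)
  have "continuous_map H.mtopology euclideanreal (hausdorff_dist K)"
    using continuous_map_mdist_alt[of H.mtopology "metric (convex_bodies, hausdorff_dist)"  "\<lambda>L. (K, L)"] assms
    by (simp add: continuous_map_pairedI)
  then show ?thesis
    by (simp add: convex_bodies_dim_ge_def continuous_map_from_subtopology)
qed


section \<open>The two actions are continuous\<close>

text \<open>It suffices to check the action laws pointwise: bijectivity of each \<open>\<phi> g\<close> follows from the action of
  the inverse.\<close>

lemma group_actionI:
  assumes G: "group G"
    and ext: "\<And>g. g \<in> carrier G \<Longrightarrow> \<phi> g \<in> extensional E"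
    and closed: "\<And>g x. g \<in> carrier G \<Longrightarrow> x \<in> E \<Longrightarrow> \<phi> g x \<in> E"
    and one: "\<And>x. x \<in> E \<Longrightarrow> \<phi> \<one>\<^bsub>G\<^esub> x = x"
    and mult: "\<And>g h x. g \<in> carrier G \<Longrightarrow> h \<in> carrier G \<Longrightarrow> x \<in> E \<Longrightarrow>
      \<phi> (g \<otimes>\<^bsub>G\<^esub> h) x = \<phi> g (\<phi> h x)"
  shows "group_action G E \<phi>"
proof -
  interpret G: group G by (rule G)
  have Bij: "\<phi> g \<in> Bij E" if g: "g \<in> carrier G" for g
  proof -
    have "bij_betw (\<phi> g) E E"
      using g closed one mult[of "inv\<^bsub>G\<^esub> g" g] mult[of g "inv\<^bsub>G\<^esub> g"]
      by (intro bij_betw_byWitness[where f' = "\<phi> (inv\<^bsub>G\<^esub> g)"]) auto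
    then show ?thesis using ext[OF g] by (simp add: Bij_def)
  qed
  have "\<phi> (g \<otimes>\<^bsub>G\<^esub> h) = compose E (\<phi> g) (\<phi> h)" if "g \<in> carrier G" "h \<in> carrier G" for g h
    using that mult ext by (intro extensionalityI[of _ E]) (auto simp: compose_def)
  then have "\<phi> \<in> hom G (BijGroup E)"
    using Bij by (auto simp: hom_def BijGroup_def)
  then show ?thesis
    by (simp add: group_action_def group_hom_def group_hom_axioms_def G group_BijGroup)
qed

lemma G_space_points:
  "G_space (similarity_group :: (real^'n \<Rightarrow> real^'n) monoid) similarity_topology
    euclidean similarity_action_point"
proof -
  interpret S: topological_group "similarity_group :: (real^'n \<Rightarrow> real^'n) monoid" similarity_topology
    by (rule topological_group_similarity_group)
  interpret group_action "similarity_group :: (real^'n \<Rightarrow> real^'n) monoid" "topspace euclidean"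
    similarity_action_point
    by (rule group_actionI) (auto simp: similarity_action_point_def S.is_group)
  let ?Z = "prod_topology (similarity_topology :: (real^'n \<Rightarrow> real^'n) topology) (euclidean :: (real^'n) topology)"
  have "continuous_map ?Z euclidean (\<lambda>z. similarity_map (sim_coords (fst z)) (snd z))"
  proof (rule continuous_map_euclidean_compose2[where h = similarity_map and g = snd
        and f = "\<lambda>z. sim_coords (fst z)"])
    show "continuous_map ?Z (top_of_set sim_params) (\<lambda>z. sim_coords (fst z))"
      using continuous_map_compose[OF continuous_map_fst continuous_map_sim_coords]
      by (simp add: o_def)
    show "continuous_map ?Z (top_of_set UNIV) snd"
      by (simp add: continuous_map_snd)
    show "continuous_on (sim_params \<times> UNIV) (\<lambda>p. similarity_map (fst p) (snd p))"
      by (simp add: similarity_map_def case_prod_unfold continuous_intros)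
  qed
  then have "continuous_map ?Z euclidean (\<lambda>(g, x). similarity_action_point g x)"
    by (rule continuous_map_eq)
      (auto simp: topspace_similarity_topology sim_coords similarity_action_point_def)
  then show ?thesis by unfold_locales
qed

lemma G_space_bodies:
  "G_space (similarity_group :: (real^'n \<Rightarrow> real^'n) monoid) similarity_topology
    (convex_bodies_dim_ge j) (similarity_action_body j)"
proof -
  interpret S: topological_group "similarity_group :: (real^'n \<Rightarrow> real^'n) monoid" similarity_topology
    by (rule topological_group_similarity_group)
  interpret group_action "similarity_group :: (real^'n \<Rightarrow> real^'n) monoid"
    "topspace (convex_bodies_dim_ge j)" "similarity_action_body j"
    by (rule group_actionI)
      (auto simp: similarity_action_body_def S.is_group convex_bodies_dim_ge_similarity_image image_comp)
  interpret H: Metric_space "convex_bodies :: (real^'n) set set" hausdorff_dist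
    by (rule Metric_space_hausdorff)
  let ?X = "convex_bodies_dim_ge j :: (real^'n) set topology"
  let ?Z = "prod_topology (similarity_topology :: (real^'n \<Rightarrow> real^'n) topology) ?X"
  let ?f = "\<lambda>(g, K :: (real^'n) set). similarity_action_body j g K"
  have "continuous_map ?Z H.mtopology ?f"
  proof (rule H.continuous_map_into_mtopology_bound)
    fix z assume "z \<in> topspace ?Z"
    then obtain g K where z: "z = (g, K)" and g: "g \<in> similarities" and K: "K \<in> topspace ?X"
      by (auto simp: topspace_similarity_topology)
    have Kb: "K \<in> convex_bodies" using topspace_bodies_subset[OF K] .
    show "?f z \<in> convex_bodies"
      using convex_bodies_similarity_image[OF g Kb] K by (simp add: z similarity_action_body_def)
    obtain u c A where p: "sim_coords g = (u, c, A)" by (cases "sim_coords g")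
    obtain R where R: "\<And>x. x \<in> K \<Longrightarrow> norm x \<le> R" "R > 0"
      using Kb compact_imp_bounded[of K] by (auto simp: convex_bodies_def bounded_pos)
    \<comment> \<open>On \<open>K\<close> the maps with parameters \<open>(u, c, A)\<close> and \<open>(v, d, B)\<close> differ by at most the first two
      terms, and the second map stretches distances by \<open>d\<close>.\<close>
    let ?\<gamma> = "\<lambda>(v, d, B) t. norm (u - v) + R * norm (c *\<^sub>R A - d *\<^sub>R B) + d * t"
    let ?\<beta> = "\<lambda>z. ?\<gamma> (sim_coords (fst z)) (hausdorff_dist K (snd z))"
    have "continuous_map ?Z euclideanreal ?\<beta>"
    proof (rule continuous_map_euclidean_compose2[where h = ?\<gamma>])
      show "continuous_map ?Z (top_of_set sim_params) (\<lambda>z. sim_coords (fst z))"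
        using continuous_map_compose[OF continuous_map_fst continuous_map_sim_coords]
        by (simp add: o_def)
      show "continuous_map ?Z (top_of_set UNIV) (\<lambda>z. hausdorff_dist K (snd z))"
        using continuous_map_compose[OF continuous_map_snd continuous_map_hausdorff_dist_from[OF Kb]]
        by (simp add: o_def)
      show "continuous_on (sim_params \<times> UNIV) (\<lambda>p. ?\<gamma> (fst p) (snd p))"
        by (simp add: case_prod_unfold continuous_intros)
    qed
    moreover have "?\<beta> z = 0" using Kb by (simp add: z p)
    moreover have "hausdorff_dist (?f z) (?f z') \<le> ?\<beta> z'" if z'_in: "z' \<in> topspace ?Z" for z'
    proof -
      obtain h L where z': "z' = (h, L)" and h: "h \<in> similarities" and L: "L \<in> topspace ?X"
        using z'_in by (auto simp: topspace_similarity_topology)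
      obtain v d B where q: "sim_coords h = (v, d, B)" by (cases "sim_coords h")
      have dB: "d > 0" "orthogonal_matrix B" and h_eq: "h = (\<lambda>x. v + d *\<^sub>R (B *v x))"
        using sim_coords[OF h] q by (auto simp: similarity_map_def)
      have g_eq: "g = (\<lambda>x. u + c *\<^sub>R (A *v x))"
        using sim_coords[OF g] p by (auto simp: similarity_map_def)
      have "dist (g x) (h x) \<le> norm (u - v) + R * norm (c *\<^sub>R A - d *\<^sub>R B)" if "x \<in> K" for x
      proof -
        have "g x - h x = (u - v) + (c *\<^sub>R A - d *\<^sub>R B) *v x"
          by (simp add: g_eq h_eq matrix_vector_mult_diff_rdistrib scaleR_matrix_vector_assoc)
        then have "dist (g x) (h x) \<le> norm (u - v) + norm ((c *\<^sub>R A - d *\<^sub>R B) *v x)"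
          by (simp add: dist_norm norm_triangle_ineq)
        also have "norm ((c *\<^sub>R A - d *\<^sub>R B) *v x) \<le> norm (c *\<^sub>R A - d *\<^sub>R B) * norm x"
          by (rule norm_matrix_vector_mult_le)
        also have "\<dots> \<le> norm (c *\<^sub>R A - d *\<^sub>R B) * R"
          using R(1)[OF that] by (intro mult_left_mono) auto
        finally show ?thesis by (simp add: mult.commute)
      qed
      then have "hausdorff_dist (g ` K) (h ` L)
          \<le> norm (u - v) + R * norm (c *\<^sub>R A - d *\<^sub>R B) + d * hausdorff_dist K L"
        using dB dist_similarity[OF dB, of v]
        by (intro hausdorff_dist_similarity_images_le g h Kb topspace_bodies_subset[OF L])
          (auto simp: h_eq)
      then show ?thesis using K L by (simp add: z z' q similarity_action_body_def)
    qed
    ultimately show "\<exists>\<beta>. continuous_map ?Z euclideanreal \<beta> \<and> \<beta> z = 0 \<and>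
        (\<forall>z'\<in>topspace ?Z. hausdorff_dist (?f z) (?f z') \<le> \<beta> z')"
      by blast
  qed
  moreover have "?f \<in> topspace ?Z \<rightarrow> {K. aff_dim K \<ge> int j}"
    by (auto simp: similarity_action_body_def topspace_similarity_topology
        topspace_convex_bodies_dim_ge aff_dim_similarity_image)
  ultimately have "continuous_map ?Z ?X ?f"
    by (subst (2) convex_bodies_dim_ge_def) (simp add: continuous_map_in_subtopology)
  then show ?thesis by unfold_locales
qed

section \<open>Weighted centres\<close>

text \<open>The second condition states that \<open>m\<close> minimises \<open>z \<mapsto> sup\<^sub>i (|z - q i|\<^sup>2 - b i)\<close> with value \<open>v\<close>, sharpened
  by the quadratic growth that uniform convexity provides. Quantifying over upper bounds \<open>s\<close> avoids
  the supremum, and the growth term yields uniqueness and stability at once.\<close>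

definition weighted_centre :: "'i set \<Rightarrow> ('i \<Rightarrow> 'a::euclidean_space) \<Rightarrow> ('i \<Rightarrow> real) \<Rightarrow> 'a \<Rightarrow> real \<Rightarrow> bool"
  where "weighted_centre I q b m v \<longleftrightarrow>
    (\<forall>i\<in>I. (dist m (q i))\<^sup>2 - b i \<le> v) \<and>
    (\<forall>z s. (\<forall>i\<in>I. (dist z (q i))\<^sup>2 - b i \<le> s) \<longrightarrow> v + (dist z m)\<^sup>2 \<le> s)"

text \<open>The supremum \<open>\<Phi>\<close> is convex, hence continuous, and grows at infinity, so it has a minimiser. Since
  \<open>\<Phi>(z) - |z|\<^sup>2\<close> is a supremum of affine functions, \<open>\<Phi>\<close> is uniformly convex, and comparing the minimum
  with the values on a segment starting at the minimiser gives the quadratic growth.\<close>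

lemma weighted_centre_exists:
  fixes q :: "'i \<Rightarrow> 'a::euclidean_space"
  assumes "I \<noteq> {}" and q: "bounded (q ` I)" and b: "bounded (b ` I)"
  shows "\<exists>m v. weighted_centre I q b m v"
proof -
  define \<Phi> where "\<Phi> z = (SUP i\<in>I. (dist z (q i))\<^sup>2 - b i)" for z
  obtain i0 where i0: "i0 \<in> I" using assms(1) by blast
  obtain Q where Q: "\<And>i. i \<in> I \<Longrightarrow> norm (q i) \<le> Q" using q by (auto simp: bounded_iff)
  obtain B where B: "\<And>i. i \<in> I \<Longrightarrow> \<bar>b i\<bar> \<le> B" using b by (auto simp: bounded_iff)
  have bdd: "bdd_above ((\<lambda>i. (dist z (q i))\<^sup>2 - b i) ` I)" for z
  proof (rule bdd_aboveI2)
    fix i assume i: "i \<in> I"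
    have "dist z (q i) \<le> norm z + Q"
      using Q[OF i] norm_triangle_ineq4[of z "q i"] by (simp add: dist_norm)
    then have "(dist z (q i))\<^sup>2 \<le> (norm z + Q)\<^sup>2" by (intro power_mono) auto
    then show "(dist z (q i))\<^sup>2 - b i \<le> (norm z + Q)\<^sup>2 + B" using B[OF i] by linarith
  qed
  have upper: "(dist z (q i))\<^sup>2 - b i \<le> \<Phi> z" if "i \<in> I" for z i
    unfolding \<Phi>_def by (rule cSUP_upper[OF that bdd])
  have least: "\<Phi> z \<le> s" if "\<And>i. i \<in> I \<Longrightarrow> (dist z (q i))\<^sup>2 - b i \<le> s" for z s
    unfolding \<Phi>_def using assms(1) that by (rule cSUP_least)
  have conv: "\<Phi> ((1 - t) *\<^sub>R x + t *\<^sub>R y) \<le> (1 - t) * \<Phi> x + t * \<Phi> y - t * (1 - t) * (dist x y)\<^sup>2"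
    if t: "0 \<le> t" "t \<le> 1" for x y t
  proof (rule least)
    fix i assume i: "i \<in> I"
    have *: "(dist ((1 - t) *\<^sub>R x + t *\<^sub>R y) (q i))\<^sup>2 =
        (1 - t) * (dist x (q i))\<^sup>2 + t * (dist y (q i))\<^sup>2 - t * (1 - t) * (dist x y)\<^sup>2"
      unfolding dist_norm power2_norm_eq_inner
      by (simp add: inner_simps inner_commute algebra_simps power2_eq_square)
    have "(1 - t) * ((dist x (q i))\<^sup>2 - b i) + t * ((dist y (q i))\<^sup>2 - b i) \<le> (1 - t) * \<Phi> x + t * \<Phi> y"
      using t upper[OF i] by (intro add_mono mult_left_mono) auto
    then show "(dist ((1 - t) *\<^sub>R x + t *\<^sub>R y) (q i))\<^sup>2 - b i
        \<le> (1 - t) * \<Phi> x + t * \<Phi> y - t * (1 - t) * (dist x y)\<^sup>2"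
      unfolding * by (simp add: algebra_simps)
  qed
  have "convex_on UNIV \<Phi>"
  proof (rule convex_onI)
    fix t :: real and x y :: 'a assume "0 < t" "t < 1"
    then have "0 \<le> t * (1 - t) * (dist x y)\<^sup>2" by simp
    with conv[of t x y] \<open>0 < t\<close> \<open>t < 1\<close>
    show "\<Phi> ((1 - t) *\<^sub>R x + t *\<^sub>R y) \<le> (1 - t) * \<Phi> x + t * \<Phi> y" by linarith
  qed simp
  then have "continuous_on UNIV \<Phi>"
    by (intro convex_on_continuous) auto
  then have cont: "continuous_on (cball (q i0) R) \<Phi>" for R
    by (rule continuous_on_subset) simp
  \<comment> \<open>Outside the ball of radius \<open>R\<close> the single index \<open>i0\<close> already pushes \<open>\<Phi>\<close> above its value at \<open>q i0\<close>.\<close>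
  define R where "R = sqrt (\<bar>\<Phi> (q i0) + b i0\<bar>)"
  have "cball (q i0) R \<noteq> {}" by (simp add: R_def)
  then obtain m where m: "m \<in> cball (q i0) R" "\<And>z. z \<in> cball (q i0) R \<Longrightarrow> \<Phi> m \<le> \<Phi> z"
    using continuous_attains_inf[OF compact_cball _ cont] by metis
  have min: "\<Phi> m \<le> \<Phi> z" for z
  proof (cases "z \<in> cball (q i0) R")
    case False
    then have "R\<^sup>2 < (dist z (q i0))\<^sup>2"
      by (intro power_strict_mono) (auto simp: dist_commute R_def)
    then have "\<Phi> (q i0) \<le> \<Phi> z"
      using upper[OF i0, of z] by (simp add: R_def)
    moreover have "\<Phi> m \<le> \<Phi> (q i0)" by (rule m(2)) (simp add: R_def)
    ultimately show ?thesis by simp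
  qed (use m in auto)
  have strong: "\<Phi> m + (dist z m)\<^sup>2 \<le> \<Phi> z" for z
  proof -
    \<comment> \<open>Compare \<open>m\<close> with the point at parameter \<open>t\<close> on the segment from \<open>m\<close> to \<open>z\<close>, divide by \<open>t\<close>, and let \<open>t\<close> tend
      to \<open>0\<close>.\<close>
    have "\<Phi> m + (1 - t) * (dist z m)\<^sup>2 \<le> \<Phi> z" if "t \<in> {0<..<1}" for t
    proof -
      have "\<Phi> m \<le> (1 - t) * \<Phi> m + t * \<Phi> z - t * (1 - t) * (dist m z)\<^sup>2"
        using conv[of t m z] min[of "(1 - t) *\<^sub>R m + t *\<^sub>R z"] that by simp
      then have "t * (\<Phi> m + (1 - t) * (dist z m)\<^sup>2) \<le> t * \<Phi> z"
        by (simp add: algebra_simps dist_commute)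
      then show ?thesis using that by simp
    qed
    then have "\<forall>\<^sub>F t in at_right 0. \<Phi> m + (1 - t) * (dist z m)\<^sup>2 \<le> \<Phi> z"
      using eventually_at_right_real[of 0 1] by (auto elim: eventually_mono)
    moreover have "((\<lambda>t. \<Phi> m + (1 - t) * (dist z m)\<^sup>2) \<longlongrightarrow> \<Phi> m + (1 - 0) * (dist z m)\<^sup>2) (at_right 0)"
      by (intro tendsto_intros)
    ultimately have "\<Phi> m + (1 - 0) * (dist z m)\<^sup>2 \<le> \<Phi> z"
      by (intro tendsto_upperbound[of _ _ "at_right (0::real)"]) simp_all
    then show ?thesis by simp
  qed
  have "weighted_centre I q b m (\<Phi> m)"
    unfolding weighted_centre_def using upper least strong by (meson order_trans)
  then show ?thesis by blast
qed

text \<open>Testing each centre against the other problem and adding the two growth inequalities cancels the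
  minimal values and leaves twice the squared distance on one side, \<open>2 e\<close> on the other.\<close>

lemma weighted_centre_stable:
  assumes "weighted_centre I q b m v" "weighted_centre I q b' m' v'"
    and close: "\<And>i. i \<in> I \<Longrightarrow> \<bar>b i - b' i\<bar> \<le> e"
  shows "(dist m m')\<^sup>2 \<le> e"
proof -
  have "\<forall>i\<in>I. (dist m' (q i))\<^sup>2 - b i \<le> v' + e"
    using assms(2) close unfolding weighted_centre_def by (smt (verit))
  then have "v + (dist m' m)\<^sup>2 \<le> v' + e"
    using assms(1) unfolding weighted_centre_def by blast
  moreover have "\<forall>i\<in>I. (dist m (q i))\<^sup>2 - b' i \<le> v + e"
    using assms(1) close unfolding weighted_centre_def by (smt (verit))
  then have "v' + (dist m m')\<^sup>2 \<le> v + e"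
    using assms(2) unfolding weighted_centre_def by blast
  ultimately show ?thesis by (simp add: dist_commute)
qed

lemma weighted_centre_unique:
  assumes "weighted_centre I q b m v" "weighted_centre I q b m' v'"
  shows "m = m'"
  using weighted_centre_stable[OF assms, of 0] by simp

section \<open>Circumscribed balls\<close>

text \<open>The weighted centre of the points of \<open>K\<close> for zero weights, with \<open>r\<^sup>2\<close> as minimal value.\<close>

definition circumball :: "'a::euclidean_space set \<Rightarrow> 'a \<Rightarrow> real \<Rightarrow> bool"
  where "circumball K c r \<longleftrightarrow> K \<subseteq> cball c r \<and> 0 \<le> r \<and>
    (\<forall>z s. K \<subseteq> cball z s \<longrightarrow> r\<^sup>2 + (dist z c)\<^sup>2 \<le> s\<^sup>2)"

lemma circumball_exists:
  assumes "bounded K" "K \<noteq> {}"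
  shows "\<exists>c r. circumball K c r"
proof -
  obtain c v where cv: "weighted_centre K id (\<lambda>_. 0) c v"
    using weighted_centre_exists[of K id "\<lambda>_. 0"] assms by (auto simp: image_constant_conv)
  obtain a where "a \<in> K" using assms(2) by blast
  then have "(dist c a)\<^sup>2 \<le> v"
    using cv unfolding weighted_centre_def by fastforce
  then have "0 \<le> v"
    using zero_le_power2[of "dist c a"] by linarith
  have "K \<subseteq> cball c (sqrt v)"
    using cv by (auto simp: weighted_centre_def real_le_rsqrt)
  moreover have "v + (dist z c)\<^sup>2 \<le> s\<^sup>2" if "K \<subseteq> cball z s" for z s
  proof -
    have "\<forall>a\<in>K. (dist z (id a))\<^sup>2 - 0 \<le> s\<^sup>2"
      using that by (auto simp: subset_iff intro!: power_mono)
    then show ?thesis using cv unfolding weighted_centre_def by blast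
  qed
  ultimately have "circumball K c (sqrt v)"
    using \<open>0 \<le> v\<close> by (simp add: circumball_def)
  then show ?thesis by blast
qed

lemma circumball_unique:
  assumes "circumball K c r" "circumball K c' r'"
  shows "c' = c" "r' = r"
proof -
  have "r\<^sup>2 + (dist c' c)\<^sup>2 \<le> r'\<^sup>2"
    using assms unfolding circumball_def by blast
  moreover have "r'\<^sup>2 + (dist c c')\<^sup>2 \<le> r\<^sup>2"
    using assms unfolding circumball_def by blast
  ultimately have "(dist c' c)\<^sup>2 = 0" "r'\<^sup>2 = r\<^sup>2"
    using zero_le_power2[of "dist c' c"] unfolding dist_commute[of c c'] by linarith+
  then show "c' = c" "r' = r"
    using assms by (auto simp: circumball_def)
qed

definition circumcentre :: "'a::euclidean_space set \<Rightarrow> 'a"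
  where "circumcentre K = (THE c. \<exists>r. circumball K c r)"

definition circumradius :: "'a::euclidean_space set \<Rightarrow> real"
  where "circumradius K = (THE r. \<exists>c. circumball K c r)"

lemma circumcentre_radius_eq:
  assumes "circumball K c r"
  shows "circumcentre K = c" "circumradius K = r"
  unfolding circumcentre_def circumradius_def
  using assms circumball_unique[OF assms] by blast+

lemma circumball_body:
  assumes "K \<in> convex_bodies"
  shows "circumball K (circumcentre K) (circumradius K)"
proof -
  obtain c r where "circumball K c r"
    using circumball_exists[of K] assms by (auto simp: convex_bodies_def compact_imp_bounded)
  then show ?thesis
    using circumcentre_radius_eq by blast
qed

lemma circumradius_pos:
  assumes "K \<in> convex_bodies" "aff_dim K \<ge> 1"
  shows "circumradius K > 0"
proof (rule ccontr)
  assume "\<not> circumradius K > 0"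
  then have "K \<subseteq> {circumcentre K}"
    using circumball_body[OF assms(1)] by (auto simp: circumball_def)
  then show False
    using aff_dim_subset[of K "{circumcentre K}"] assms(2) by simp
qed

lemma circumball_similarity_image:
  fixes A :: "real^'n^'n"
  assumes c: "c > 0" "orthogonal_matrix A" and K: "circumball K p r"
  shows "circumball ((\<lambda>x. u + c *\<^sub>R (A *v x)) ` K) (u + c *\<^sub>R (A *v p)) (c * r)"
proof -
  let ?g = "\<lambda>x. u + c *\<^sub>R (A *v x)"
  have "(c * r)\<^sup>2 + (dist z (?g p))\<^sup>2 \<le> s\<^sup>2" if "?g ` K \<subseteq> cball z s" for z s
  proof -
    obtain h where "?g \<circ> h = id"
      using similarity_inverse[OF similaritiesI[OF c]] by metis
    then have "?g (h z) = z" by (metis comp_apply id_apply)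
    then obtain y where y: "z = ?g y" by metis
    have "K \<subseteq> cball y (s / c)"
      using that c by (auto simp: y dist_similarity[OF c] field_simps image_subset_iff
          simp del: dist_add_cancel)
    then have "r\<^sup>2 + (dist y p)\<^sup>2 \<le> (s / c)\<^sup>2"
      using K by (auto simp: circumball_def)
    then have "c\<^sup>2 * (r\<^sup>2 + (dist y p)\<^sup>2) \<le> s\<^sup>2"
      using c by (simp add: power_divide field_simps)
    then show ?thesis
      unfolding y dist_similarity[OF c] by (simp add: power_mult_distrib algebra_simps)
  qed
  moreover have "?g ` K \<subseteq> cball (?g p) (c * r)"
    using K c unfolding image_subset_iff mem_cball dist_similarity[OF c]
    by (auto simp: circumball_def)
  moreover have "0 \<le> c * r"
    using K c by (simp add: circumball_def)
  ultimately show ?thesis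
    unfolding circumball_def by blast
qed

lemma circumcentre_similarity_image:
  fixes A :: "real^'n^'n"
  assumes "c > 0" "orthogonal_matrix A" "K \<in> convex_bodies"
  shows "circumcentre ((\<lambda>x. u + c *\<^sub>R (A *v x)) ` K) = u + c *\<^sub>R (A *v circumcentre K)"
    and "circumradius ((\<lambda>x. u + c *\<^sub>R (A *v x)) ` K) = c * circumradius K"
  using circumcentre_radius_eq[OF circumball_similarity_image[OF assms(1,2) circumball_body[OF assms(3)]]]
  by simp_all

lemma subset_cball_hausdorff_dist:
  assumes "K \<in> convex_bodies" "L \<in> convex_bodies"
  shows "L \<subseteq> cball (circumcentre K) (circumradius K + hausdorff_dist K L)"
proof
  fix b assume "b \<in> L"
  then obtain a where "a \<in> K" "dist a b \<le> hausdorff_dist K L"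
    using hausdorff_dist_near(2)[OF assms] by blast
  moreover have "dist (circumcentre K) a \<le> circumradius K"
    using circumball_body[OF assms(1)] \<open>a \<in> K\<close> by (auto simp: circumball_def)
  ultimately show "b \<in> cball (circumcentre K) (circumradius K + hausdorff_dist K L)"
    using dist_triangle[of "circumcentre K" b a] by simp
qed

text \<open>The growth inequality for \<open>L\<close>, applied to the ball around the circumcentre of \<open>K\<close> that is enlarged
  just enough to contain \<open>L\<close>.\<close>

lemma circumball_hausdorff_dist:
  assumes K: "K \<in> convex_bodies" and L: "L \<in> convex_bodies"
  shows "(circumradius L)\<^sup>2 + (dist (circumcentre K) (circumcentre L))\<^sup>2
    \<le> (circumradius K + hausdorff_dist K L)\<^sup>2"
  using circumball_body[OF L] subset_cball_hausdorff_dist[OF K L] by (simp add: circumball_def)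

lemma circumradius_le:
  assumes K: "K \<in> convex_bodies" and L: "L \<in> convex_bodies"
  shows "circumradius L \<le> circumradius K + hausdorff_dist K L"
proof (rule power2_le_imp_le)
  show "(circumradius L)\<^sup>2 \<le> (circumradius K + hausdorff_dist K L)\<^sup>2"
    using circumball_hausdorff_dist[OF assms]
      zero_le_power2[of "dist (circumcentre K) (circumcentre L)"] by linarith
  show "0 \<le> circumradius K + hausdorff_dist K L"
    using circumball_body[OF K] hausdorff_dist_nonneg[of K L] by (simp add: circumball_def)
qed

lemma circumradius_lipschitz:
  assumes K: "K \<in> convex_bodies" and L: "L \<in> convex_bodies"
  shows "dist (circumradius K) (circumradius L) \<le> hausdorff_dist K L"
  using circumradius_le[OF K L] circumradius_le[OF L K] hausdorff_dist_commute[of K L]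
  by (simp add: dist_real_def)

text \<open>The squared radii in the growth inequality differ by \<open>O(\<delta>)\<close>, so the growth term
  bounds the distance of the centres to order \<open>sqrt \<delta>\<close>.\<close>

lemma circumcentre_dist_le:
  assumes K: "K \<in> convex_bodies" and L: "L \<in> convex_bodies"
  defines "\<delta> \<equiv> hausdorff_dist K L"
  shows "dist (circumcentre K) (circumcentre L) \<le> sqrt (4 * circumradius K * \<delta> + 4 * \<delta>\<^sup>2)"
proof (rule real_le_rsqrt)
  have nn: "0 \<le> circumradius K" "0 \<le> circumradius L" "0 \<le> \<delta>"
    using circumball_body[OF K] circumball_body[OF L] hausdorff_dist_nonneg[of K L]
    by (auto simp: circumball_def \<delta>_def)
  have "(circumradius K)\<^sup>2 + (dist (circumcentre L) (circumcentre K))\<^sup>2 \<le> (circumradius L + \<delta>)\<^sup>2"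
    using circumball_hausdorff_dist[OF L K] by (simp add: \<delta>_def hausdorff_dist_commute)
  also have "\<dots> \<le> (circumradius K + 2 * \<delta>)\<^sup>2"
    using circumradius_le[OF K L] nn by (intro power_mono) (auto simp: \<delta>_def)
  finally show "(dist (circumcentre K) (circumcentre L))\<^sup>2 \<le> 4 * circumradius K * \<delta> + 4 * \<delta>\<^sup>2"
    by (simp add: power2_sum dist_commute algebra_simps)
qed

lemma continuous_map_circumradius:
  "continuous_map (convex_bodies_dim_ge j) euclideanreal circumradius"
proof (rule continuous_map_into_euclidean_bound)
  fix K :: "'a set" assume "K \<in> topspace (convex_bodies_dim_ge j)"
  then have K: "K \<in> convex_bodies" by (rule topspace_bodies_subset)
  have "hausdorff_dist K K = 0"
    using Metric_space.mdist_zero[OF Metric_space_hausdorff K] .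
  then show "\<exists>\<beta>. continuous_map (convex_bodies_dim_ge j) euclideanreal \<beta> \<and> \<beta> K = 0 \<and>
      (\<forall>L\<in>topspace (convex_bodies_dim_ge j). dist (circumradius K) (circumradius L) \<le> \<beta> L)"
    using continuous_map_hausdorff_dist_from[OF K] circumradius_lipschitz[OF K] topspace_bodies_subset
    by (intro exI[of _ "hausdorff_dist K"]) auto
qed

lemma continuous_map_circumcentre:
  "continuous_map (convex_bodies_dim_ge j) euclidean circumcentre"
proof (rule continuous_map_into_euclidean_bound)
  fix K :: "'a set" assume "K \<in> topspace (convex_bodies_dim_ge j)"
  then have K: "K \<in> convex_bodies" by (rule topspace_bodies_subset)
  let ?\<beta> = "\<lambda>L. sqrt (4 * circumradius K * hausdorff_dist K L + 4 * (hausdorff_dist K L)\<^sup>2)"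
  have "continuous_map (convex_bodies_dim_ge j) euclideanreal ?\<beta>"
    by (intro continuous_intros continuous_map_hausdorff_dist_from[OF K])
  moreover have "?\<beta> K = 0"
    using Metric_space.mdist_zero[OF Metric_space_hausdorff K] by simp
  ultimately show "\<exists>\<beta>. continuous_map (convex_bodies_dim_ge j) euclideanreal \<beta> \<and> \<beta> K = 0 \<and>
      (\<forall>L\<in>topspace (convex_bodies_dim_ge j). dist (circumcentre K) (circumcentre L) \<le> \<beta> L)"
    using circumcentre_dist_le[OF K] topspace_bodies_subset by blast
qed

section \<open>Normal forms of bodies\<close>

definition normal_form :: "(real^'n) set \<Rightarrow> (real^'n) set"
  where "normal_form K = (\<lambda>x. (1 / circumradius K) *\<^sub>R (x - circumcentre K)) ` K"

lemma normalising_similarity: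
  assumes "r > 0"
  shows "(\<lambda>x :: real^'n. (1 / r) *\<^sub>R (x - p)) \<in> similarities"
  using similaritiesI[of "1 / r" "mat 1" "- ((1 / r) *\<^sub>R p)"] assms
  by (simp add: orthogonal_matrix_id scaleR_right_diff_distrib)

lemma normal_form_body:
  assumes "K \<in> convex_bodies" "aff_dim K \<ge> 1"
  shows "normal_form K \<in> convex_bodies"
  unfolding normal_form_def
  by (intro convex_bodies_similarity_image normalising_similarity circumradius_pos assms)

lemma normal_form_similarity_image:
  fixes A :: "real^'n^'n"
  assumes c: "c > 0" "orthogonal_matrix A" and K: "K \<in> convex_bodies"
  shows "normal_form ((\<lambda>x. u + c *\<^sub>R (A *v x)) ` K) = (*v) A ` normal_form K"
  using c(1) unfolding normal_form_def circumcentre_similarity_image[OF assms] image_image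
  by (intro image_cong) (simp_all add: matrix_vector_mult_scaleR matrix_vector_mult_diff_distrib
      flip: scaleR_right_diff_distrib)

text \<open>The bound has only the fixed radius of \<open>K\<close> in the denominator and is thus continuous in \<open>L\<close>.\<close>

lemma normal_form_dist_le:
  fixes K L :: "(real^'n) set"
  assumes K: "K \<in> convex_bodies" "aff_dim K \<ge> 1" and L: "L \<in> convex_bodies" "aff_dim L \<ge> 1"
  shows "hausdorff_dist (normal_form K) (normal_form L) \<le>
    (dist (circumradius K) (circumradius L) + dist (circumcentre K) (circumcentre L)
      + hausdorff_dist K L) / circumradius K"
proof -
  let ?r = "circumradius K" and ?s = "circumradius L" and ?p = "circumcentre K" and ?q = "circumcentre L"
  have r: "?r > 0" and s: "?s > 0" using circumradius_pos K L by auto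
  \<comment> \<open>The two maps are compared on \<open>L\<close>, where \<open>|x - q| \<le> s\<close> cancels the factor \<open>1 / s\<close>.\<close>
  have "hausdorff_dist ((\<lambda>x. (1 / ?s) *\<^sub>R (x - ?q)) ` L) ((\<lambda>x. (1 / ?r) *\<^sub>R (x - ?p)) ` K)
      \<le> (dist ?r ?s + dist ?p ?q) / ?r + (1 / ?r) * hausdorff_dist L K"
  proof (rule hausdorff_dist_similarity_images_le)
    fix x assume x: "x \<in> L"
    have "dist ((1 / ?s) *\<^sub>R (x - ?q)) ((1 / ?r) *\<^sub>R (x - ?p))
        = norm ((1 / ?s - 1 / ?r) *\<^sub>R (x - ?q) + (1 / ?r) *\<^sub>R (?p - ?q))"
      by (simp add: dist_norm algebra_simps)
    also have "\<dots> \<le> \<bar>1 / ?s - 1 / ?r\<bar> * norm (x - ?q) + (1 / ?r) * norm (?p - ?q)"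
      using norm_triangle_ineq[of "(1 / ?s - 1 / ?r) *\<^sub>R (x - ?q)" "(1 / ?r) *\<^sub>R (?p - ?q)"] r by simp
    also have "\<bar>1 / ?s - 1 / ?r\<bar> * norm (x - ?q) \<le> \<bar>1 / ?s - 1 / ?r\<bar> * ?s"
      using circumball_body[OF L(1)] x
      by (intro mult_left_mono) (auto simp: circumball_def dist_norm norm_minus_commute)
    also have "\<dots> = \<bar>(1 / ?s - 1 / ?r) * ?s\<bar>" using s by (simp add: abs_mult)
    also have "(1 / ?s - 1 / ?r) * ?s = (?r - ?s) / ?r" using r s by (simp add: field_simps)
    finally show "dist ((1 / ?s) *\<^sub>R (x - ?q)) ((1 / ?r) *\<^sub>R (x - ?p)) \<le> (dist ?r ?s + dist ?p ?q) / ?r"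
      using r by (simp add: dist_norm abs_divide add_divide_distrib)
  next
    fix x y
    show "dist ((1 / ?r) *\<^sub>R (x - ?p)) ((1 / ?r) *\<^sub>R (y - ?p)) \<le> 1 / ?r * dist x y"
      using r by (simp add: dist_norm flip: scaleR_right_diff_distrib)
  qed (use K L r s in \<open>auto intro: normalising_similarity\<close>)
  then show ?thesis
    by (simp add: normal_form_def hausdorff_dist_commute add_divide_distrib)
qed

lemma normal_form_inverse:
  assumes "K \<in> convex_bodies" "aff_dim K \<ge> 1"
  shows "K = (\<lambda>x. circumcentre K + circumradius K *\<^sub>R x) ` normal_form K"
  using circumradius_pos[OF assms] by (simp add: normal_form_def image_image)

text \<open>Orbits of bodies under similarities correspond to orbits of normal forms under orthogonal matrices.
  For \<open>L = K\<close> this turns a symmetry of the normal form into an element of the stabilizer of \<open>K\<close>.\<close>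

lemma similarity_of_normal_forms:
  fixes A :: "real^'n^'n"
  assumes K: "K \<in> convex_bodies" "aff_dim K \<ge> 1" and L: "L \<in> convex_bodies" "aff_dim L \<ge> 1"
    and A: "orthogonal_matrix A" and eq: "normal_form L = (*v) A ` normal_form K"
  shows "L = (\<lambda>x. circumcentre L + (circumradius L / circumradius K) *\<^sub>R (A *v (x - circumcentre K))) ` K"
proof -
  have "L = (\<lambda>x. circumcentre L + circumradius L *\<^sub>R (A *v ((1 / circumradius K) *\<^sub>R (x - circumcentre K)))) ` K"
    by (subst normal_form_inverse[OF L]) (simp only: eq normal_form_def[of K] image_image)
  then show ?thesis by (simp add: matrix_vector_mult_scaleR)
qed

section \<open>Orthogonal images of bodies\<close>

lemma convex_bodies_orthogonal_image:
  assumes "orthogonal_matrix (A :: real^'n^'n)" "K \<in> convex_bodies"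
  shows "(*v) A ` K \<in> convex_bodies"
  using convex_bodies_similarity_image[OF similaritiesI[OF zero_less_one assms(1), of 0] assms(2)]
  by simp

lemma hausdorff_dist_orthogonal_image:
  assumes "orthogonal_matrix (A :: real^'n^'n)" "K \<in> convex_bodies" "L \<in> convex_bodies"
  shows "hausdorff_dist ((*v) A ` K) ((*v) A ` L) = hausdorff_dist K L"
  using hausdorff_dist_similarity_image[OF zero_less_one assms, of 0] by simp

lemma hausdorff_dist_orthogonal_image_shift:
  assumes A: "orthogonal_matrix (A :: real^'n^'n)" and B: "orthogonal_matrix B"
    and KL: "K \<in> convex_bodies" "L \<in> convex_bodies"
  shows "hausdorff_dist ((*v) A ` K) ((*v) B ` L) = hausdorff_dist K ((*v) (transpose A ** B) ` L)"
proof -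
  have "(*v) B ` L = (*v) A ` (*v) (transpose A ** B) ` L"
    by (simp add: image_image orthogonal_matrix_cancel[OF A] del: transpose_matrix_vector
        flip: matrix_vector_mul_assoc)
  then show ?thesis
    using A B KL
    by (simp add: hausdorff_dist_orthogonal_image convex_bodies_orthogonal_image
        orthogonal_matrix_mul orthogonal_matrix_transposeI)
qed

lemma continuous_on_hausdorff_dist_orthogonal:
  fixes M N :: "(real^'n) set"
  assumes M: "M \<in> convex_bodies" and N: "N \<in> convex_bodies"
  shows "continuous_on orthogonal_matrices (\<lambda>A. hausdorff_dist M ((*v) A ` N))"
proof -
  obtain R where R: "\<And>x. x \<in> N \<Longrightarrow> norm x \<le> R" "R > 0"
    using N compact_imp_bounded[of N] by (auto simp: convex_bodies_def bounded_pos)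
  have "R-lipschitz_on orthogonal_matrices (\<lambda>A. hausdorff_dist M ((*v) A ` N))"
  proof (rule lipschitz_onI)
    fix A B :: "real^'n^'n" assume "A \<in> orthogonal_matrices" "B \<in> orthogonal_matrices"
    then have A: "orthogonal_matrix A" and B: "orthogonal_matrix B" by auto
    have "dist (0 + 1 *\<^sub>R (A *v x)) (0 + 1 *\<^sub>R (B *v x)) \<le> R * dist A B" if "x \<in> N" for x
    proof -
      have "dist (A *v x) (B *v x) \<le> dist A B * norm x"
        using norm_matrix_vector_mult_le[of "A - B" x]
        by (simp add: dist_norm matrix_vector_mult_diff_rdistrib)
      also have "\<dots> \<le> dist A B * R" using R(1)[OF that] by (intro mult_left_mono) auto
      finally show ?thesis by (simp add: mult.commute)
    qed
    then have "hausdorff_dist ((\<lambda>x. 0 + 1 *\<^sub>R (A *v x)) ` N) ((\<lambda>x. 0 + 1 *\<^sub>R (B *v x)) ` N)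
        \<le> R * dist A B + 1 * hausdorff_dist N N"
      by (intro hausdorff_dist_similarity_images_le similaritiesI A B N)
        (auto simp: dist_orthogonal_matrix_mult[OF B])
    then have "hausdorff_dist ((*v) A ` N) ((*v) B ` N) \<le> R * dist A B"
      using Metric_space.mdist_zero[OF Metric_space_hausdorff N] by simp
    then show "dist (hausdorff_dist M ((*v) A ` N)) (hausdorff_dist M ((*v) B ` N)) \<le> R * dist A B"
      using hausdorff_dist_reverse_triangle[of "(*v) A ` N" "(*v) B ` N" M]
        convex_bodies_orthogonal_image[OF A N] convex_bodies_orthogonal_image[OF B N] M
      by (simp add: dist_real_def hausdorff_dist_commute)
  qed (use R in simp)
  then show ?thesis by (rule lipschitz_on_continuous_on)
qed

text \<open>A modulus of continuity at \<open>N\<close> of the map \<open>AN \<mapsto> Aw\<close> on the orbit of \<open>N\<close>, which is well defined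
  by the hypothesis. It is linear up to \<open>\<epsilon>\<close> because the weights in the minimisation are
  multiples of the distance.\<close>

lemma orthogonal_displacement_le:
  fixes N :: "(real^'n) set" and w :: "real^'n"
  assumes N: "N \<in> convex_bodies"
    and fixed: "\<And>A. orthogonal_matrix A \<Longrightarrow> (*v) A ` N = N \<Longrightarrow> A *v w = w"
    and "\<epsilon> > 0"
  obtains L where "L \<ge> 0"
    "\<And>A. orthogonal_matrix A \<Longrightarrow> (dist w (A *v w))\<^sup>2 \<le> \<epsilon> + L * hausdorff_dist N ((*v) A ` N)"
proof (cases "\<exists>A. orthogonal_matrix A \<and> \<epsilon> \<le> (dist w (A *v w))\<^sup>2")
  case False
  show thesis by (rule that[of 0]) (use False in \<open>auto simp: not_le less_imp_le\<close>)
next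
  case True
  \<comment> \<open>The matrices that move \<open>w\<close> substantially form a compact set, and none of them preserves \<open>N\<close>, so their
    images of \<open>N\<close> stay at a distance \<open>\<mu> > 0\<close> from \<open>N\<close>. The displacement of \<open>w\<close> never exceeds \<open>2 |w|\<close>.\<close>
  let ?S = "orthogonal_matrices \<inter> {A. \<epsilon> \<le> (dist w (A *v w))\<^sup>2}"
  have "closed {A :: real^'n^'n. \<epsilon> \<le> (dist w (A *v w))\<^sup>2}"
    by (intro closed_Collect_le continuous_intros)
  then have "compact ?S"
    using compact_orthogonal_matrices by blast
  moreover have "continuous_on ?S (\<lambda>A. hausdorff_dist N ((*v) A ` N))"
    using continuous_on_hausdorff_dist_orthogonal[OF N N] by (rule continuous_on_subset) auto
  ultimately obtain A0 where A0: "A0 \<in> ?S"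
    and min: "\<And>A. A \<in> ?S \<Longrightarrow> hausdorff_dist N ((*v) A0 ` N) \<le> hausdorff_dist N ((*v) A ` N)"
    using continuous_attains_inf[of ?S "\<lambda>A. hausdorff_dist N ((*v) A ` N)"] True by blast
  define \<mu> where "\<mu> = hausdorff_dist N ((*v) A0 ` N)"
  have "\<mu> \<noteq> 0"
  proof
    assume "\<mu> = 0"
    then have "(*v) A0 ` N = N"
      using Metric_space.zero[OF Metric_space_hausdorff N, of "(*v) A0 ` N"]
        convex_bodies_orthogonal_image[OF _ N, of A0] A0 by (auto simp: \<mu>_def)
    then show False using fixed[of A0] A0 \<open>\<epsilon> > 0\<close> by auto
  qed
  then have \<mu>: "\<mu> > 0" using hausdorff_dist_nonneg[of N] by (simp add: \<mu>_def less_le)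
  define L where "L = (2 * norm w)\<^sup>2 / \<mu>"
  have "L \<ge> 0" using \<mu> by (simp add: L_def)
  then show thesis
  proof (rule that)
    fix A :: "real^'n^'n" assume A: "orthogonal_matrix A"
    show "(dist w (A *v w))\<^sup>2 \<le> \<epsilon> + L * hausdorff_dist N ((*v) A ` N)"
    proof (cases "A \<in> ?S")
      case True
      have "dist w (A *v w) \<le> 2 * norm w"
        using norm_triangle_ineq4[of w "A *v w"] norm_orthogonal_matrix_mult[OF A, of w]
        by (simp add: dist_norm)
      then have "(dist w (A *v w))\<^sup>2 \<le> (2 * norm w)\<^sup>2" by (intro power_mono) auto
      also have "\<dots> = L * \<mu>" using \<mu> by (simp add: L_def)
      also have "\<dots> \<le> L * hausdorff_dist N ((*v) A ` N)"
        using min[OF True] \<open>L \<ge> 0\<close> by (simp add: \<mu>_def mult_left_mono)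
      finally show ?thesis using \<open>\<epsilon> > 0\<close> by simp
    next
      case False
      then have "(dist w (A *v w))\<^sup>2 \<le> \<epsilon>" using A by simp
      moreover have "0 \<le> L * hausdorff_dist N ((*v) A ` N)"
        by (intro mult_nonneg_nonneg \<open>L \<ge> 0\<close> hausdorff_dist_nonneg)
      ultimately show ?thesis by linarith
    qed
  qed
qed

section \<open>Equivariant maps with a prescribed value\<close>

definition linear_part_equivariant :: "nat \<Rightarrow> ((real^'n) set \<Rightarrow> real^'n) \<Rightarrow> bool"
  where "linear_part_equivariant j F \<longleftrightarrow>
    continuous_map (convex_bodies_dim_ge j) euclidean F \<and>
    (\<forall>u c A. \<forall>K \<in> topspace (convex_bodies_dim_ge j). c > 0 \<longrightarrow> orthogonal_matrix A \<longrightarrow>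
      F ((\<lambda>x. u + c *\<^sub>R (A *v x)) ` K) = A *v F K)"

lemma bodies_dim_ge:
  assumes "K \<in> topspace (convex_bodies_dim_ge j)" "1 \<le> j"
  shows "K \<in> convex_bodies" "aff_dim K \<ge> 1"
  using assms by (auto simp: topspace_convex_bodies_dim_ge)

lemma continuous_map_normal_form_dist:
  assumes K: "K \<in> topspace (convex_bodies_dim_ge j)" and j: "1 \<le> j"
  shows "\<exists>\<beta>. continuous_map (convex_bodies_dim_ge j) euclideanreal \<beta> \<and> \<beta> K = 0 \<and>
    (\<forall>L \<in> topspace (convex_bodies_dim_ge j). hausdorff_dist (normal_form K) (normal_form L) \<le> \<beta> L)"
proof -
  note Kb = bodies_dim_ge[OF K j]
  let ?\<beta> = "\<lambda>L. (\<bar>circumradius K - circumradius L\<bar> + norm (circumcentre K - circumcentre L)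
      + hausdorff_dist K L) / circumradius K"
  have "continuous_map (convex_bodies_dim_ge j) euclideanreal ?\<beta>"
    using circumradius_pos[OF Kb]
    by (intro continuous_intros continuous_map_hausdorff_dist_from[OF Kb(1)]
        continuous_map_circumradius continuous_map_circumcentre) auto
  moreover have "?\<beta> K = 0"
    using Metric_space.mdist_zero[OF Metric_space_hausdorff Kb(1)] by simp
  moreover have "hausdorff_dist (normal_form K) (normal_form L) \<le> ?\<beta> L"
    if L: "L \<in> topspace (convex_bodies_dim_ge j)" for L
    using normal_form_dist_le[OF Kb bodies_dim_ge[OF L j]] by (simp add: dist_norm)
  ultimately show ?thesis by (intro exI[of _ ?\<beta>]) blast
qed

text \<open>The map is the weighted centre of the points \<open>Aw\<close> with weights \<open>L d\<^sub>H(M', AN)\<close>, \<open>M'\<close> the normal form of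
  \<open>M\<close>: matrices with \<open>AN\<close> far from \<open>M'\<close> are discounted. Replacing \<open>M'\<close> by \<open>AM'\<close> permutes the
  points and their weights in the same way, so the centre moves by \<open>A\<close>.\<close>

lemma ex_linear_part_equivariant_near:
  fixes K :: "(real^'n) set" and w :: "real^'n"
  assumes K: "K \<in> topspace (convex_bodies_dim_ge j)" and j: "1 \<le> j"
    and fixed: "\<And>A. orthogonal_matrix A \<Longrightarrow> (*v) A ` normal_form K = normal_form K \<Longrightarrow> A *v w = w"
    and "\<epsilon> > 0"
  shows "\<exists>F. linear_part_equivariant j F \<and> (dist w (F K))\<^sup>2 \<le> \<epsilon>"
proof -
  let ?X = "convex_bodies_dim_ge j :: (real^'n) set topology"
  define N where "N = normal_form K"
  have N: "N \<in> convex_bodies"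
    unfolding N_def by (rule normal_form_body[OF bodies_dim_ge[OF K j]])
  obtain L where L: "L \<ge> 0"
    "\<And>A. orthogonal_matrix A \<Longrightarrow> (dist w (A *v w))\<^sup>2 \<le> \<epsilon> + L * hausdorff_dist N ((*v) A ` N)"
    using orthogonal_displacement_le[OF N fixed[folded N_def] \<open>\<epsilon> > 0\<close>] by blast
  define b where "b M A = L * hausdorff_dist (normal_form M) ((*v) A ` N)" for M and A :: "real^'n^'n"
  let ?q = "\<lambda>A :: real^'n^'n. A *v w"
  define F where "F M = (SOME m. \<exists>v. weighted_centre orthogonal_matrices ?q (b M) m v)" for M
  have F: "\<exists>v. weighted_centre orthogonal_matrices ?q (b M) (F M) v" if M: "M \<in> topspace ?X" for M
  proof -
    note Mb = bodies_dim_ge[OF M j]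
    have "orthogonal_matrix (mat 1 :: real^'n^'n)" by (rule orthogonal_matrix_id)
    then have "(orthogonal_matrices :: (real^'n^'n) set) \<noteq> {}" by blast
    moreover have "bounded (?q ` orthogonal_matrices)"
      by (auto simp: bounded_iff norm_orthogonal_matrix_mult)
    moreover have "continuous_on orthogonal_matrices (b M)"
      unfolding b_def
      by (intro continuous_intros continuous_on_hausdorff_dist_orthogonal normal_form_body Mb N)
    then have "bounded (b M ` orthogonal_matrices)"
      using compact_continuous_image compact_orthogonal_matrices compact_imp_bounded by blast
    ultimately have "\<exists>m v. weighted_centre orthogonal_matrices ?q (b M) m v"
      by (rule weighted_centre_exists)
    then show ?thesis unfolding F_def by (rule someI_ex)
  qed
  have "continuous_map ?X euclidean F"
  proof (rule continuous_map_into_euclidean_bound)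
    fix M assume M: "M \<in> topspace ?X"
    obtain \<beta> where \<beta>: "continuous_map ?X euclideanreal \<beta>" "\<beta> M = 0"
      "\<And>M'. M' \<in> topspace ?X \<Longrightarrow> hausdorff_dist (normal_form M) (normal_form M') \<le> \<beta> M'"
      using continuous_map_normal_form_dist[OF M j] by blast
    have "dist (F M) (F M') \<le> sqrt (L * \<beta> M')" if M': "M' \<in> topspace ?X" for M'
    proof (rule real_le_rsqrt)
      obtain v v' where "weighted_centre orthogonal_matrices ?q (b M) (F M) v"
        "weighted_centre orthogonal_matrices ?q (b M') (F M') v'"
        using F[OF M] F[OF M'] by blast
      moreover have "\<bar>b M A - b M' A\<bar> \<le> L * \<beta> M'" if "A \<in> orthogonal_matrices" for A
      proof -
        have "\<bar>hausdorff_dist (normal_form M) ((*v) A ` N) - hausdorff_dist (normal_form M') ((*v) A ` N)\<bar>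
            \<le> hausdorff_dist (normal_form M) (normal_form M')"
          using that by (intro hausdorff_dist_reverse_triangle normal_form_body
              bodies_dim_ge[OF M j] bodies_dim_ge[OF M' j] convex_bodies_orthogonal_image N) auto
        also have "\<dots> \<le> \<beta> M'" by (rule \<beta>(3)[OF M'])
        finally show ?thesis
          using L(1) by (simp add: b_def abs_mult mult_left_mono flip: right_diff_distrib)
      qed
      ultimately show "(dist (F M) (F M'))\<^sup>2 \<le> L * \<beta> M'"
        by (rule weighted_centre_stable)
    qed
    moreover have "continuous_map ?X euclideanreal (\<lambda>M'. sqrt (L * \<beta> M'))"
      by (intro continuous_intros \<beta>(1))
    ultimately show "\<exists>\<gamma>. continuous_map ?X euclideanreal \<gamma> \<and> \<gamma> M = 0 \<and>
        (\<forall>M'\<in>topspace ?X. dist (F M) (F M') \<le> \<gamma> M')"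
      using \<beta>(2) by (intro exI[of _ "\<lambda>M'. sqrt (L * \<beta> M')"]) simp
  qed
  moreover have "F ((\<lambda>x. u + c *\<^sub>R (A *v x)) ` M) = A *v F M"
    if M: "M \<in> topspace ?X" and c: "c > 0" and A: "orthogonal_matrix A" for u c A M
  proof -
    let ?gM = "(\<lambda>x. u + c *\<^sub>R (A *v x)) ` M"
    note Mb = bodies_dim_ge[OF M j]
    have gM: "?gM \<in> topspace ?X"
      by (rule convex_bodies_dim_ge_similarity_image[OF similaritiesI[OF c A] M])
    have tA: "orthogonal_matrix (transpose A)" by (rule orthogonal_matrix_transposeI[OF A])
    obtain v where v: "weighted_centre orthogonal_matrices ?q (b M) (F M) v" using F[OF M] by blast
    obtain v' where v': "weighted_centre orthogonal_matrices ?q (b ?gM) (F ?gM) v'" using F[OF gM] by blast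
    \<comment> \<open>Passing from \<open>M\<close> to its image and from \<open>z\<close> to \<open>Az\<close> merely reindexes the family by \<open>B \<mapsto> A\<^sup>T B\<close>.\<close>
    have term_eq: "(dist (A *v z) (B *v w))\<^sup>2 - b ?gM B
        = (dist z ((transpose A ** B) *v w))\<^sup>2 - b M (transpose A ** B)"
      if B: "orthogonal_matrix B" for z B
    proof -
      have "dist (A *v z) (B *v w) = dist (A *v z) (A *v ((transpose A ** B) *v w))"
        by (simp add: orthogonal_matrix_cancel[OF A] del: transpose_matrix_vector
            flip: matrix_vector_mul_assoc)
      then have "dist (A *v z) (B *v w) = dist z ((transpose A ** B) *v w)"
        by (simp add: dist_orthogonal_matrix_mult[OF A])
      then show ?thesis
        by (simp add: b_def normal_form_similarity_image[OF c A Mb(1)]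
            hausdorff_dist_orthogonal_image_shift[OF A B normal_form_body[OF Mb] N])
    qed
    have all_eq: "(\<forall>B\<in>orthogonal_matrices. (dist (A *v z) (B *v w))\<^sup>2 - b ?gM B \<le> s) \<longleftrightarrow>
        (\<forall>B\<in>orthogonal_matrices. (dist z (B *v w))\<^sup>2 - b M B \<le> s)" for z s
    proof (intro iffI ballI)
      fix B :: "real^'n^'n" assume *: "\<forall>B\<in>orthogonal_matrices. (dist (A *v z) (B *v w))\<^sup>2 - b ?gM B \<le> s"
        and "B \<in> orthogonal_matrices"
      then have B: "orthogonal_matrix (A ** B)" using A by (simp add: orthogonal_matrix_mul)
      have "transpose A ** (A ** B) = B"
        using A by (simp add: matrix_mul_assoc orthogonal_matrix_def)
      then show "(dist z (B *v w))\<^sup>2 - b M B \<le> s" using * B term_eq[OF B, of z] by auto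
    next
      fix B :: "real^'n^'n" assume *: "\<forall>B\<in>orthogonal_matrices. (dist z (B *v w))\<^sup>2 - b M B \<le> s"
        and "B \<in> orthogonal_matrices"
      then show "(dist (A *v z) (B *v w))\<^sup>2 - b ?gM B \<le> s"
        using tA by (simp add: term_eq orthogonal_matrix_mul)
    qed
    have "weighted_centre orthogonal_matrices ?q (b ?gM) (A *v F M) v"
      unfolding weighted_centre_def
    proof (intro conjI allI impI)
      show "\<forall>B\<in>orthogonal_matrices. (dist (A *v F M) (B *v w))\<^sup>2 - b ?gM B \<le> v"
        unfolding all_eq using v by (simp add: weighted_centre_def)
    next
      fix z s assume *: "\<forall>B\<in>orthogonal_matrices. (dist z (B *v w))\<^sup>2 - b ?gM B \<le> s"
      have z: "z = A *v (transpose A *v z)" by (simp only: orthogonal_matrix_cancel[OF A])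
      have "v + (dist (transpose A *v z) (F M))\<^sup>2 \<le> s"
        using v * all_eq[of "transpose A *v z" s] unfolding z[symmetric] weighted_centre_def by blast
      then show "v + (dist z (A *v F M))\<^sup>2 \<le> s"
        by (subst z) (simp only: dist_orthogonal_matrix_mult[OF A])
    qed
    then show ?thesis using weighted_centre_unique[OF v'] by metis
  qed
  moreover have "(dist w (F K))\<^sup>2 \<le> \<epsilon>"
  proof -
    obtain v where v: "weighted_centre orthogonal_matrices ?q (b K) (F K) v" using F[OF K] by blast
    \<comment> \<open>By the choice of \<open>L\<close> the supremum at \<open>w\<close> is at most \<open>\<epsilon>\<close>, and the minimum is nonnegative because of the
      term of the identity matrix, whose weight is \<open>0\<close>. Quadratic growth bounds the distance to \<open>w\<close>.\<close>
    have "\<forall>A\<in>orthogonal_matrices. (dist w (A *v w))\<^sup>2 - b K A \<le> \<epsilon>"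
      using L(2) by (auto simp: b_def N_def algebra_simps)
    then have "v + (dist w (F K))\<^sup>2 \<le> \<epsilon>"
      using v unfolding weighted_centre_def by blast
    moreover have "(dist (F K) (mat 1 *v w))\<^sup>2 - b K (mat 1) \<le> v"
      using v orthogonal_matrix_id unfolding weighted_centre_def by blast
    then have "(dist (F K) w)\<^sup>2 \<le> v"
      using Metric_space.mdist_zero[OF Metric_space_hausdorff N] by (simp add: b_def N_def[symmetric])
    then have "0 \<le> v" by (rule order_trans[OF zero_le_power2])
    ultimately show ?thesis by linarith
  qed
  ultimately show ?thesis
    unfolding linear_part_equivariant_def by blast
qed

text \<open>Approximate values suffice because the attained values form a subspace, which is closed.\<close>

lemma ex_linear_part_equivariant_value:
  fixes K :: "(real^'n) set" and w :: "real^'n"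
  assumes K: "K \<in> topspace (convex_bodies_dim_ge j)" and j: "1 \<le> j"
    and fixed: "\<And>A. orthogonal_matrix A \<Longrightarrow> (*v) A ` normal_form K = normal_form K \<Longrightarrow> A *v w = w"
  shows "\<exists>F. linear_part_equivariant j F \<and> F K = w"
proof -
  let ?V = "(\<lambda>F. F K) ` {F. linear_part_equivariant j F}"
  have "subspace ?V"
  proof (rule subspaceI)
    have "linear_part_equivariant j (\<lambda>_. 0)"
      by (simp add: linear_part_equivariant_def)
    then show "0 \<in> ?V" by force
  next
    fix x y assume "x \<in> ?V" "y \<in> ?V"
    then obtain F F' where "linear_part_equivariant j F" "linear_part_equivariant j F'"
      "x = F K" "y = F' K" by auto
    moreover from this(1,2) have "linear_part_equivariant j (\<lambda>M. F M + F' M)"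
      by (simp add: linear_part_equivariant_def matrix_vector_right_distrib continuous_map_add)
    ultimately show "x + y \<in> ?V" by force
  next
    fix t x assume "x \<in> ?V"
    then obtain F where "linear_part_equivariant j F" "x = F K" by auto
    moreover from this(1) have "linear_part_equivariant j (\<lambda>M. t *\<^sub>R F M)"
      by (simp add: linear_part_equivariant_def matrix_vector_mult_scaleR continuous_map_scaleR_euclidean)
    ultimately show "t *\<^sub>R x \<in> ?V" by force
  qed
  then have "closed ?V" by (rule closed_subspace)
  moreover have "w \<in> closure ?V"
    unfolding closure_approachable
  proof (intro allI impI)
    fix e :: real assume "e > 0"
    then obtain F where F: "linear_part_equivariant j F" "(dist w (F K))\<^sup>2 \<le> (e / 2)\<^sup>2"
      using ex_linear_part_equivariant_near[OF K j fixed, of "(e / 2)\<^sup>2"] by auto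
    have "dist w (F K) \<le> e / 2" by (rule power2_le_imp_le[OF F(2)]) (use \<open>e > 0\<close> in simp)
    then show "\<exists>y\<in>?V. dist y w < e" using F(1) \<open>e > 0\<close> by (force simp: dist_commute)
  qed
  ultimately have "w \<in> ?V" by (simp add: closure_closed)
  then show ?thesis by auto
qed

section \<open>Separating orbits\<close>

text \<open>Here \<open>N\<close> stands for a body that is already in normal form, so only \<open>K\<close> is normalised.\<close>

definition orbit_dist :: "(real^'n) set \<Rightarrow> (real^'n) set \<Rightarrow> real"
  where "orbit_dist N K = (INF A\<in>orthogonal_matrices. hausdorff_dist (normal_form K) ((*v) A ` N))"

lemma orbit_dist_le:
  assumes "orthogonal_matrix A"
  shows "orbit_dist N K \<le> hausdorff_dist (normal_form K) ((*v) A ` N)"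
  unfolding orbit_dist_def
  by (rule cINF_lower[OF bdd_belowI2[where m = 0]]) (use assms hausdorff_dist_nonneg in auto)

lemma orbit_dist_attained:
  assumes N: "N \<in> convex_bodies" and K: "K \<in> convex_bodies" "aff_dim K \<ge> 1"
  obtains A where "orthogonal_matrix A" "orbit_dist N K = hausdorff_dist (normal_form K) ((*v) A ` N)"
proof -
  have ne: "orthogonal_matrices \<noteq> ({} :: (real^'a^'a) set)" using orthogonal_matrix_id by blast
  obtain A where A: "A \<in> orthogonal_matrices" "\<And>B. B \<in> orthogonal_matrices \<Longrightarrow>
      hausdorff_dist (normal_form K) ((*v) A ` N) \<le> hausdorff_dist (normal_form K) ((*v) B ` N)"
    using continuous_attains_inf[OF compact_orthogonal_matrices ne
        continuous_on_hausdorff_dist_orthogonal[OF normal_form_body[OF K] N]] by blast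
  have "hausdorff_dist (normal_form K) ((*v) A ` N) \<le> orbit_dist N K"
    unfolding orbit_dist_def by (rule cINF_greatest[OF ne A(2)])
  then have "orbit_dist N K = hausdorff_dist (normal_form K) ((*v) A ` N)"
    using orbit_dist_le[of A N K] A(1) by simp
  then show thesis using that A(1) by blast
qed

lemma orbit_dist_similarity_image:
  fixes A :: "real^'n^'n"
  assumes N: "N \<in> convex_bodies" and K: "K \<in> convex_bodies" "aff_dim K \<ge> 1"
    and c: "c > 0" and A: "orthogonal_matrix A"
  shows "orbit_dist N ((\<lambda>x. u + c *\<^sub>R (A *v x)) ` K) = orbit_dist N K"
proof -
  let ?gK = "(\<lambda>x. u + c *\<^sub>R (A *v x)) ` K"
  have tA: "orthogonal_matrix (transpose A)" by (rule orthogonal_matrix_transposeI[OF A])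
  have g: "(\<lambda>x. u + c *\<^sub>R (A *v x)) \<in> similarities" by (rule similaritiesI[OF c A])
  have gK: "?gK \<in> convex_bodies" "aff_dim ?gK \<ge> 1"
    using convex_bodies_similarity_image[OF g K(1)] aff_dim_similarity_image[OF g, of K] K(2) by simp_all
  have shift: "hausdorff_dist (normal_form ?gK) ((*v) B ` N) =
      hausdorff_dist (normal_form K) ((*v) (transpose A ** B) ` N)" if "orthogonal_matrix B" for B
    using hausdorff_dist_orthogonal_image_shift[OF A that normal_form_body[OF K] N]
    by (simp add: normal_form_similarity_image[OF c A K(1)])
  show ?thesis
  proof (rule order_antisym)
    obtain B where B: "orthogonal_matrix B" "orbit_dist N K = hausdorff_dist (normal_form K) ((*v) B ` N)"
      using orbit_dist_attained[OF N K] .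
    have "transpose A ** (A ** B) = B" using A by (simp add: matrix_mul_assoc orthogonal_matrix_def)
    then show "orbit_dist N ?gK \<le> orbit_dist N K"
      using orbit_dist_le[OF orthogonal_matrix_mul[OF A B(1)], of N ?gK]
        shift[OF orthogonal_matrix_mul[OF A B(1)]] B(2) by simp
    obtain B where B: "orthogonal_matrix B" "orbit_dist N ?gK = hausdorff_dist (normal_form ?gK) ((*v) B ` N)"
      using orbit_dist_attained[OF N gK] .
    then show "orbit_dist N K \<le> orbit_dist N ?gK"
      using orbit_dist_le[OF orthogonal_matrix_mul[OF tA B(1)], of N K] shift[OF B(1)] by simp
  qed
qed

lemma continuous_map_orbit_dist:
  assumes N: "N \<in> convex_bodies" and j: "1 \<le> j"
  shows "continuous_map (convex_bodies_dim_ge j) euclideanreal (orbit_dist N)"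
proof (rule continuous_map_into_euclidean_bound)
  fix K :: "(real^'a) set" assume K: "K \<in> topspace (convex_bodies_dim_ge j)"
  have le: "orbit_dist N L \<le> orbit_dist N M + hausdorff_dist (normal_form L) (normal_form M)"
    if L: "L \<in> topspace (convex_bodies_dim_ge j)" and M: "M \<in> topspace (convex_bodies_dim_ge j)" for L M
  proof -
    obtain A where A: "orthogonal_matrix A" "orbit_dist N M = hausdorff_dist (normal_form M) ((*v) A ` N)"
      using orbit_dist_attained[OF N bodies_dim_ge[OF M j]] .
    have "orbit_dist N L \<le> hausdorff_dist (normal_form L) ((*v) A ` N)"
      by (rule orbit_dist_le[OF A(1)])
    also have "\<dots> \<le> hausdorff_dist (normal_form L) (normal_form M) + hausdorff_dist (normal_form M) ((*v) A ` N)"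
      by (intro Metric_space.triangle[OF Metric_space_hausdorff] normal_form_body
          bodies_dim_ge[OF L j] bodies_dim_ge[OF M j] convex_bodies_orthogonal_image A N)
    finally show ?thesis using A(2) by simp
  qed
  have "dist (orbit_dist N K) (orbit_dist N L) \<le> hausdorff_dist (normal_form K) (normal_form L)"
    if "L \<in> topspace (convex_bodies_dim_ge j)" for L
    using le[OF K that] le[OF that K] hausdorff_dist_commute[of "normal_form K"]
    by (simp add: dist_real_def)
  then show "\<exists>\<beta>. continuous_map (convex_bodies_dim_ge j) euclideanreal \<beta> \<and> \<beta> K = 0 \<and>
      (\<forall>L\<in>topspace (convex_bodies_dim_ge j). dist (orbit_dist N K) (orbit_dist N L) \<le> \<beta> L)"
    using continuous_map_normal_form_dist[OF K j] by (meson order_trans)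
qed

section \<open>The extension property\<close>

lemma similarity_about:
  assumes "c > 0" "orthogonal_matrix A"
  shows "(\<lambda>x. q + c *\<^sub>R (A *v (x - p))) \<in> similarities"
  using similaritiesI[OF assms, of "q - c *\<^sub>R (A *v p)"]
  by (simp add: matrix_vector_mult_diff_distrib algebra_simps)

theorem theorem4p6:
  fixes i :: nat
  assumes "i \<in> {1..CARD('n::finite)}"
  shows "G_finite_extension_property
    (similarity_group :: (real^'n \<Rightarrow> real^'n) monoid) similarity_topology
    (convex_bodies_dim_ge i) (similarity_action_body i)
    euclidean similarity_action_point"
  unfolding G_finite_extension_property_def
proof (intro conjI allI impI)
  let ?G = "similarity_group :: (real^'n \<Rightarrow> real^'n) monoid"
  let ?X = "convex_bodies_dim_ge i :: (real^'n) set topology"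
  have i: "1 \<le> i" using assms by simp
  show "G_space ?G similarity_topology ?X (similarity_action_body i)" by (rule G_space_bodies)
  show "G_space ?G similarity_topology euclidean similarity_action_point" by (rule G_space_points)
  fix k :: nat and x :: "nat \<Rightarrow> (real^'n) set" and y :: "nat \<Rightarrow> real^'n"
  assume xy: "\<forall>l\<in>{1..k}. x l \<in> topspace ?X \<and> y l \<in> topspace euclidean"
    and stab: "\<forall>l\<in>{1..k}. stabilizer ?G (similarity_action_body i) (x l)
      \<subseteq> stabilizer ?G similarity_action_point (y l)"
    and disj: "\<forall>l\<in>{1..k}. \<forall>j\<in>{1..k}. l \<noteq> j \<longrightarrow>
      orbit ?G (similarity_action_body i) (x l) \<inter> orbit ?G (similarity_action_body i) (x j) = {}"
  let ?p = "\<lambda>l. circumcentre (x l)" and ?r = "\<lambda>l. circumradius (x l)"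
  define N where "N l = normal_form (x l)" for l
  have x: "x l \<in> topspace ?X" and xb: "x l \<in> convex_bodies" "aff_dim (x l) \<ge> 1"
    and r: "?r l > 0" and N: "N l \<in> convex_bodies" if "l \<in> {1..k}" for l
    using xy that bodies_dim_ge[of "x l" i] i circumradius_pos[of "x l"] normal_form_body[of "x l"]
    by (auto simp: N_def)
  have "\<exists>F. linear_part_equivariant i F \<and> F (x l) = (1 / ?r l) *\<^sub>R (y l - ?p l)" if l: "l \<in> {1..k}" for l
  proof (rule ex_linear_part_equivariant_value[OF x[OF l] i])
    fix A :: "real^'n^'n" assume A: "orthogonal_matrix A" and eq: "(*v) A ` normal_form (x l) = normal_form (x l)"
    \<comment> \<open>A symmetry of the normal form, conjugated back to a similarity about the circumcentre, stabilizes
      \<open>x l\<close> and hence \<open>y l\<close>.\<close>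
    let ?g = "\<lambda>z. ?p l + 1 *\<^sub>R (A *v (z - ?p l))"
    have g: "?g \<in> similarities" by (rule similarity_about[OF zero_less_one A])
    have "?g ` x l = x l"
      using similarity_of_normal_forms[OF xb[OF l] xb[OF l] A eq[symmetric]] r[OF l] by simp
    then have "?g \<in> stabilizer ?G (similarity_action_body i) (x l)"
      using g x[OF l] by (simp add: stabilizer_def similarity_action_body_def)
    then have "?g (y l) = y l"
      using subsetD[OF bspec[OF stab l]] unfolding stabilizer_def similarity_action_point_def by blast
    then have "A *v (y l - ?p l) = y l - ?p l" by (simp add: algebra_simps)
    then show "A *v ((1 / ?r l) *\<^sub>R (y l - ?p l)) = (1 / ?r l) *\<^sub>R (y l - ?p l)"
      by (simp only: matrix_vector_mult_scaleR)
  qed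
  then obtain F where F: "\<And>l. l \<in> {1..k} \<Longrightarrow> linear_part_equivariant i (F l)"
    and F_val: "\<And>l. l \<in> {1..k} \<Longrightarrow> F l (x l) = (1 / ?r l) *\<^sub>R (y l - ?p l)"
    by metis
  have same_orbit: "orbit_dist (N l) (x l) = 0" if l: "l \<in> {1..k}" for l
  proof (rule order_antisym)
    show "orbit_dist (N l) (x l) \<le> 0"
      using orbit_dist_le[OF orthogonal_matrix_id, of "N l" "x l"]
        Metric_space.mdist_zero[OF Metric_space_hausdorff N[OF l]] by (simp add: N_def)
    show "0 \<le> orbit_dist (N l) (x l)"
      using orbit_dist_attained[OF N[OF l] xb[OF l]] hausdorff_dist_nonneg by metis
  qed
  have other_orbit: "orbit_dist (N j) (x l) \<noteq> 0" if l: "l \<in> {1..k}" and j: "j \<in> {1..k}" and "l \<noteq> j" for l j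
  proof
    assume zero: "orbit_dist (N j) (x l) = 0"
    obtain A where A: "orthogonal_matrix A" "orbit_dist (N j) (x l) = hausdorff_dist (N l) ((*v) A ` N j)"
      using orbit_dist_attained[OF N[OF j] xb[OF l]] unfolding N_def by metis
    have "N l = (*v) A ` N j"
      using Metric_space.zero[OF Metric_space_hausdorff N[OF l]
          convex_bodies_orthogonal_image[OF A(1) N[OF j]]] zero A(2) by simp
    then have eq: "x l = (\<lambda>z. ?p l + (?r l / ?r j) *\<^sub>R (A *v (z - ?p j))) ` x j"
      unfolding N_def by (rule similarity_of_normal_forms[OF xb[OF j] xb[OF l] A(1)])
    have g: "(\<lambda>z. ?p l + (?r l / ?r j) *\<^sub>R (A *v (z - ?p j))) \<in> similarities"
      using r l j A(1) by (intro similarity_about) auto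
    have "x l \<in> orbit ?G (similarity_action_body i) (x j)"
      unfolding orbit_def using g x[OF j] eq
      by (auto simp: similarity_action_body_def intro!: exI[of _ "\<lambda>z. ?p l + (?r l / ?r j) *\<^sub>R (A *v (z - ?p j))"])
    moreover have "id \<in> similarities"
      using group.is_monoid[OF group_similarity_group, THEN monoid.one_closed] by simp
    then have "x l \<in> orbit ?G (similarity_action_body i) (x l)"
      unfolding orbit_def using x[OF l]
      by (auto simp: similarity_action_body_def intro!: exI[of _ id])
    ultimately show False using disj l j \<open>l \<noteq> j\<close> by blast
  qed
  \<comment> \<open>Lagrange-type interpolation coefficients: invariant, equal to \<open>1\<close> at \<open>x l\<close> and to \<open>0\<close> at the other
    prescribed bodies.\<close>
  define coef where "coef l K = (\<Prod>j\<in>{1..k} - {l}. orbit_dist (N j) K / orbit_dist (N j) (x l))" for l K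
  define f where "f K = circumcentre K + circumradius K *\<^sub>R (\<Sum>l=1..k. coef l K *\<^sub>R F l K)" for K
  have "continuous_map ?X euclidean f"
    unfolding f_def coef_def using F other_orbit
    by (intro continuous_intros continuous_map_scaleR_euclidean continuous_map_circumcentre
        continuous_map_circumradius continuous_map_orbit_dist N i)
      (auto simp: linear_part_equivariant_def)
  moreover have "f (similarity_action_body i g K) = similarity_action_point g (f K)"
    if g_in: "g \<in> carrier ?G" and K: "K \<in> topspace ?X" for g K
  proof -
    have "g \<in> similarities" using g_in by simp
    then obtain u c A where c: "c > 0" and A: "orthogonal_matrix A"
      and g: "g = (\<lambda>x. u + c *\<^sub>R (A *v x))"
      by (rule similaritiesE)
    note Kb = bodies_dim_ge[OF K i]
    have "coef l (g ` K) = coef l K" for l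
      unfolding coef_def g using orbit_dist_similarity_image[OF N Kb c A]
      by (intro prod.cong) auto
    moreover have "F l (g ` K) = A *v F l K" if "l \<in> {1..k}" for l
      using F[OF that] K c A by (simp add: linear_part_equivariant_def g)
    ultimately have "(\<Sum>l=1..k. coef l (g ` K) *\<^sub>R F l (g ` K)) = A *v (\<Sum>l=1..k. coef l K *\<^sub>R F l K)"
      by (simp add: matrix_vector_mult_scaleR vec.sum)
    then have "f (g ` K) = u + c *\<^sub>R (A *v f K)"
      using circumcentre_similarity_image[OF c A Kb(1), of u]
      by (simp add: f_def g matrix_vector_right_distrib matrix_vector_mult_scaleR algebra_simps)
    then show ?thesis using K by (simp add: similarity_action_body_def similarity_action_point_def g)
  qed
  moreover have "f (x l) = y l" if l: "l \<in> {1..k}" for l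
  proof -
    have "coef m (x l) = (if m = l then 1 else 0)" if m: "m \<in> {1..k}" for m
      using l m same_orbit[OF l] other_orbit[OF l] by (auto simp: coef_def intro!: prod.neutral)
    then have "(\<Sum>m=1..k. coef m (x l) *\<^sub>R F m (x l)) = (\<Sum>m=1..k. if m = l then F m (x l) else 0)"
      by (intro sum.cong) auto
    also have "\<dots> = F l (x l)" using l by simp
    finally show ?thesis using F_val[OF l] r[OF l] by (simp add: f_def)
  qed
  ultimately show "\<exists>f. G_map ?G ?X (similarity_action_body i) euclidean similarity_action_point f
      \<and> (\<forall>l\<in>{1..k}. f (x l) = y l)"
    unfolding G_map_def by blast
qed

end
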